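(* Let $\mathcal E$ and $\mathcal E_\ast$ be separable Hilbert spaces, let $F\in H^\infty(\mathcal E\to\mathcal E_\ast)$ be an inner function, and suppose that $\dim\big(\mathcal E_\ast\ominus F(\lambda)\mathcal E\big)<\infty$ for some $\lambda\in\mathbb D$. If $F$ is left invertible, then $$\sup_{z\in\mathbb D}\|I_{\mathcal E}-F(z)^\ast F(z)\|_{\mathfrak S_1}<\infty .$$
   Context: $\mathbb D$ is the open unit disk, $\mathbb T$ the unit circle, $m$ the normalized Lebesgue measure on $\mathbb T$. Hilbert spaces are complex. $H^\infty(\mathcal E\to\mathcal E_\ast)$ is the space of bounded analytic functions on $\mathbb D$ whose values are bounded linear operators from $\mathcal E$ to $\mathcal E_\ast$. Every such $F$ has nontangential boundary values $F(\zeta)$ (in the strong operator topology) for $m$-a.e. $\zeta\in\mathbb T$. $F$ is called inner if $F(\zeta)$ is an isometry for a.e. $\zeta\in\mathbb T$. $F$ is called left invertible if there exists $G\in H^\infty(\mathcal E_\ast\to\mathcal E)$ such that $G(z)F(z)=I_{\mathcal E}$ for all $z\in\mathbb D$. $\mathcal E_\ast\ominus F(\lambda)\mathcal E$ denotes the orthogonal complement in $\mathcal E_\ast$ of the range of $F(\lambda)$. $\mathfrak S_1$ is the trace class of operators and $\|\cdot\|_{\mathfrak S_1}$ is the trace norm (equal to $+\infty$ for an operator not in $\mathfrak S_1$). *)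

theory Defs
  imports "HOL-Analysis.Analysis"
begin

section \<open>Complex Hilbert spaces\<close>

class complex_vector = real_vector +
  fixes scaleC :: "complex \<Rightarrow> 'a \<Rightarrow> 'a" (infixr \<open>*\<^sub>C\<close> 75)
  assumes scaleC_add_right: "a *\<^sub>C (x + y) = a *\<^sub>C x + a *\<^sub>C y"
    and scaleC_add_left: "(a + b) *\<^sub>C x = a *\<^sub>C x + b *\<^sub>C x"
    and scaleC_scaleC: "a *\<^sub>C b *\<^sub>C x = (a * b) *\<^sub>C x"
    and scaleC_of_real: "complex_of_real r *\<^sub>C x = r *\<^sub>R x"

class complex_normed_vector = complex_vector + real_normed_vector +
  assumes norm_scaleC: "norm (a *\<^sub>C x) = cmod a * norm x"

text \<open>The complex inner product is linear in the first argument. The underlying real Hilbert space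
  carries its real part, so the norm is the usual one. Positivity and definiteness are inherited
  from \<^class>\<open>real_inner\<close>, since \<open>cinner x x\<close> is real by conjugate symmetry.\<close>

class complex_inner = complex_vector + real_inner +
  fixes cinner :: "'a \<Rightarrow> 'a \<Rightarrow> complex"
  assumes cinner_commute: "cinner x y = cnj (cinner y x)"
    and cinner_add_left: "cinner (x + y) z = cinner x z + cinner y z"
    and cinner_scaleC_left: "cinner (a *\<^sub>C x) y = a * cinner x y"
    and Re_cinner: "Re (cinner x y) = inner x y"

class chilbert_space = complex_inner + complete_space

lemma cinner_self: "cinner x x = complex_of_real ((norm x)\<^sup>2)"
  for x :: "'a::complex_inner"
proof (rule complex_eqI)
  have "Im (cinner x x) = - Im (cinner x x)"
    using arg_cong[OF cinner_commute[of x x], of Im] by simp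
  then show "Im (cinner x x) = Im (complex_of_real ((norm x)\<^sup>2))" by simp
qed (simp add: Re_cinner power2_norm_eq_inner)

instance complex_inner \<subseteq> complex_normed_vector
proof
  fix a :: complex and x :: 'a
  have "cinner (a *\<^sub>C x) (a *\<^sub>C x) = a * cnj (cinner (a *\<^sub>C x) x)"
    by (metis cinner_scaleC_left cinner_commute)
  also have "\<dots> = a * cnj a * cinner x x"
    by (simp add: cinner_scaleC_left cinner_self)
  finally have "complex_of_real ((norm (a *\<^sub>C x))\<^sup>2) = complex_of_real ((cmod a * norm x)\<^sup>2)"
    by (simp add: cinner_self complex_norm_square power_mult_distrib flip: of_real_power)
  then have "(norm (a *\<^sub>C x))\<^sup>2 = (cmod a * norm x)\<^sup>2"
    by (simp only: of_real_eq_iff)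
  then show "norm (a *\<^sub>C x) = cmod a * norm x"
    by (simp add: power2_eq_iff_nonneg)
qed

global_interpretation complex_vector: vector_space "scaleC :: complex \<Rightarrow> 'a \<Rightarrow> 'a::complex_vector"
  defines cspan = complex_vector.span
  by unfold_locales
    (simp_all add: scaleC_add_right scaleC_add_left scaleC_scaleC scaleC_of_real[of 1, simplified])

definition finite_dimensional :: "'a::complex_vector set \<Rightarrow> bool" where
  "finite_dimensional S \<longleftrightarrow> (\<exists>B. finite B \<and> S = cspan B)"

definition ortho_complement :: "'a::complex_inner set \<Rightarrow> 'a set" where
  "ortho_complement S = {y. \<forall>x\<in>S. cinner x y = 0}"

definition orthonormal_basis :: "'a::complex_inner set \<Rightarrow> bool" where
  "orthonormal_basis B \<longleftrightarrow>
     (\<forall>x\<in>B. \<forall>y\<in>B. cinner x y = (if x = y then 1 else 0)) \<and> closure (cspan B) = UNIV"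

section \<open>Bounded complex-linear operators\<close>

text \<open>\<^typ>\<open>'a \<Rightarrow>\<^sub>L 'b\<close> is the space of bounded real-linear operators with the operator
  norm; the complex-linear ones are singled out by \<open>clinear_op\<close>.\<close>

instantiation blinfun :: (real_normed_vector, complex_normed_vector) complex_normed_vector
begin

lift_definition scaleC_blinfun :: "complex \<Rightarrow> 'a \<Rightarrow>\<^sub>L 'b \<Rightarrow> 'a \<Rightarrow>\<^sub>L 'b" is "\<lambda>c f x. c *\<^sub>C f x"
proof -
  fix c :: complex and f :: "'a \<Rightarrow> 'b"
  assume f: "bounded_linear f"
  interpret f: bounded_linear f by fact
  show "bounded_linear (\<lambda>x. c *\<^sub>C f x)"
  proof (rule bounded_linear_intro)
    show "c *\<^sub>C f (r *\<^sub>R x) = r *\<^sub>R c *\<^sub>C f x" for r x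
      by (simp add: f.scaleR scaleC_scaleC mult.commute flip: scaleC_of_real)
    show "norm (c *\<^sub>C f x) \<le> norm x * (cmod c * onorm f)" for x
      using mult_left_mono[OF onorm[OF f, of x], of "cmod c"] by (simp add: norm_scaleC ac_simps)
  qed (simp add: f.add scaleC_add_right)
qed

instance
proof
  fix a b :: complex and r :: real and A B :: "'a \<Rightarrow>\<^sub>L 'b"
  show "a *\<^sub>C (A + B) = a *\<^sub>C A + a *\<^sub>C B"
    by transfer (simp add: scaleC_add_right)
  show "(a + b) *\<^sub>C A = a *\<^sub>C A + b *\<^sub>C A"
    by transfer (simp add: scaleC_add_left)
  show "a *\<^sub>C b *\<^sub>C A = (a * b) *\<^sub>C A"
    by transfer (simp add: scaleC_scaleC)
  show "complex_of_real r *\<^sub>C A = r *\<^sub>R A"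
    by transfer (simp add: scaleC_of_real)
  have le: "norm (c *\<^sub>C C) \<le> cmod c * norm C" for c and C :: "'a \<Rightarrow>\<^sub>L 'b"
    by (rule norm_blinfun_bound)
       (simp_all add: scaleC_blinfun.rep_eq norm_scaleC mult.assoc mult_left_mono norm_blinfun)
  show "norm (a *\<^sub>C A) = cmod a * norm A"
  proof (cases "a = 0")
    case True
    then show ?thesis using le[of 0 A] by simp
  next
    case False
    have "inverse a *\<^sub>C a *\<^sub>C A = A"
      using False by transfer (simp add: scaleC_scaleC)
    then have "norm A \<le> inverse (cmod a) * norm (a *\<^sub>C A)"
      using le[of "inverse a" "a *\<^sub>C A"] by (simp add: norm_inverse)
    then have "cmod a * norm A \<le> norm (a *\<^sub>C A)"
      using False by (simp add: field_simps)
    with le[of a A] show ?thesis by simp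
  qed
qed

end

definition clinear_op :: "('a::complex_normed_vector \<Rightarrow>\<^sub>L 'b::complex_normed_vector) \<Rightarrow> bool" where
  "clinear_op A \<longleftrightarrow> (\<forall>c x. A (c *\<^sub>C x) = c *\<^sub>C A x)"

definition isometry :: "('a::complex_normed_vector \<Rightarrow>\<^sub>L 'b::complex_normed_vector) \<Rightarrow> bool" where
  "isometry A \<longleftrightarrow> (\<forall>x. norm (A x) = norm x)"

text \<open>\<open>cadjoint\<close>, \<open>abs_op\<close> and \<open>trace_norm\<close> below are meant for complex-linear operators only: an
  adjoint with respect to \<open>cinner\<close> does not exist otherwise.\<close>

definition cadjoint :: "('a::chilbert_space \<Rightarrow>\<^sub>L 'b::chilbert_space) \<Rightarrow> 'b \<Rightarrow>\<^sub>L 'a" where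
  "cadjoint A = (THE B :: 'b \<Rightarrow>\<^sub>L 'a. \<forall>x y. cinner (A x) y = cinner x (B y))"

definition positive_op :: "('a::chilbert_space \<Rightarrow>\<^sub>L 'a) \<Rightarrow> bool" where
  "positive_op A \<longleftrightarrow> clinear_op A \<and> (\<forall>x. cinner (A x) x \<in> \<real>\<^sub>\<ge>\<^sub>0)"

text \<open>The modulus of \<open>A\<close>, i.e. the positive square root of \<open>A\<^sup>* A\<close>.\<close>

definition abs_op :: "('a::chilbert_space \<Rightarrow>\<^sub>L 'a) \<Rightarrow> 'a \<Rightarrow>\<^sub>L 'a" where
  "abs_op A = (THE P. positive_op P \<and> P o\<^sub>L P = cadjoint A o\<^sub>L A)"

text \<open>The trace of the modulus. The sum has nonnegative terms, so it always exists in
  \<^typ>\<open>ennreal\<close>; it does not depend on the orthonormal basis, and it is \<open>\<infinity>\<close> exactly when the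
  operator is not of trace class.\<close>

definition trace_norm :: "('a::chilbert_space \<Rightarrow>\<^sub>L 'a) \<Rightarrow> ennreal" where
  "trace_norm A =
     (\<Sum>\<^sub>\<infinity>e\<in>(SOME B. orthonormal_basis B). ennreal (Re (cinner (abs_op A e) e)))"

section \<open>Bounded analytic operator-valued functions on the unit disk\<close>

abbreviation unit_disk :: "complex set" where
  "unit_disk \<equiv> ball 0 1"

abbreviation unit_circle :: "complex set" where
  "unit_circle \<equiv> sphere 0 1"

definition has_complex_derivative ::
  "(complex \<Rightarrow> 'a::complex_normed_vector) \<Rightarrow> 'a \<Rightarrow> complex \<Rightarrow> bool" where
  "has_complex_derivative f D z \<longleftrightarrow> ((\<lambda>w. inverse (w - z) *\<^sub>C (f w - f z)) \<longlongrightarrow> D) (at z)"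

definition H_infty :: "(complex \<Rightarrow> 'a::chilbert_space \<Rightarrow>\<^sub>L 'b::chilbert_space) set" where
  "H_infty = {F. (\<forall>z\<in>unit_disk. clinear_op (F z)) \<and>
                 (\<forall>z\<in>unit_disk. \<exists>D. has_complex_derivative F D z) \<and>
                 bounded (F ` unit_disk)}"

definition circle_measure :: "complex measure" where
  "circle_measure = distr (uniform_measure lborel {0..<2 * pi}) (restrict_space borel unit_circle) cis"

text \<open>Nontangential approach region with vertex \<open>\<zeta>\<close>; a nontangential limit is a limit within every
  such region with aperture \<open>\<alpha> > 1\<close>.\<close>

definition stolz_region :: "real \<Rightarrow> complex \<Rightarrow> complex set" where
  "stolz_region \<alpha> \<zeta> = {z \<in> unit_disk. cmod (z - \<zeta>) < \<alpha> * (1 - cmod z)}"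

definition has_boundary_value ::
  "(complex \<Rightarrow> 'a::chilbert_space \<Rightarrow>\<^sub>L 'b::chilbert_space) \<Rightarrow> 'a \<Rightarrow>\<^sub>L 'b \<Rightarrow> complex \<Rightarrow> bool" where
  "has_boundary_value F A \<zeta> \<longleftrightarrow>
     (\<forall>\<alpha>>1. \<forall>x. ((\<lambda>z. F z x) \<longlongrightarrow> A x) (at \<zeta> within stolz_region \<alpha> \<zeta>))"

definition inner_function ::
  "(complex \<Rightarrow> 'a::chilbert_space \<Rightarrow>\<^sub>L 'b::chilbert_space) \<Rightarrow> bool" where
  "inner_function F \<longleftrightarrow>
     (AE \<zeta> in circle_measure. \<exists>A. has_boundary_value F A \<zeta> \<and> isometry A)"

definition left_invertible ::
  "(complex \<Rightarrow> 'a::chilbert_space \<Rightarrow>\<^sub>L 'b::chilbert_space) \<Rightarrow> bool" where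
  "left_invertible F \<longleftrightarrow> (\<exists>G\<in>H_infty. \<forall>z\<in>unit_disk. G z o\<^sub>L F z = id_blinfun)"

end

theory Submission
  imports Defs "HOL-Complex_Analysis.Complex_Analysis"
begin

text \<open>Let \<open>G F = I\<close> and \<open>Q = I - F G\<close>. Then \<open>Q\<close> is bounded and analytic, its values are idempotents
  of one and the same finite rank, and \<open>Q F = 0\<close>. Fix \<open>a\<close> in the disk and let \<open>\<mu>\<close> be the harmonic
  measure of \<open>a\<close> on the circle. For a vector \<open>e\<close> put \<open>h = (F - F(a)) e\<close>, so that \<open>h = F G h + Q h\<close>
  and \<open>Q h = - Q F(a) e\<close>. Since \<open>F\<close> is isometric on the circle and \<open>h\<close> vanishes at \<open>a\<close>, the mean
  value property makes \<open>h\<close> orthogonal to \<open>F G h\<close> in \<open>L\<^sup>2(\<mu>)\<close>. Hence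
  \<open>\<parallel>e\<parallel>\<^sup>2 - \<parallel>F(a) e\<parallel>\<^sup>2 = \<integral> \<parallel>h\<parallel>\<^sup>2 d\<mu> \<le> \<integral> \<parallel>Q F(a) e\<parallel>\<^sup>2 d\<mu>\<close>.
  Summing over an orthonormal basis bounds the trace of \<open>I - F(a)\<^sup>* F(a)\<close> by the integral of the
  squared Hilbert-Schmidt norm of \<open>Q F(a)\<close>, which is controlled by the rank and the operator norm.
  As \<open>G\<close> need not have strong boundary values, all integrals are taken over circles of radius
  \<open>r < 1\<close>, where \<open>F\<close> fails to be isometric by a defect that vanishes as \<open>r \<rightarrow> 1\<close>.\<close>

section \<open>Hilbert space geometry\<close>

lemma inner_scaleC_right: "inner x (c *\<^sub>C y) = inner (cnj c *\<^sub>C x) y" for x :: "'a::complex_inner"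
proof -
  have "cinner x (c *\<^sub>C y) = cnj c * cinner x y"
    by (metis cinner_commute cinner_scaleC_left complex_cnj_mult complex_cnj_cnj)
  then show ?thesis by (simp flip: Re_cinner cinner_scaleC_left)
qed

text \<open>Rotating the first argument by \<open>\<i>\<close> recovers the imaginary part from the
  real inner product. This lets orthogonality and adjoints be treated in the underlying real Hilbert
  space.\<close>

lemma Im_cinner: "Im (cinner x y) = - inner (\<i> *\<^sub>C x) y" for x :: "'a::complex_inner"
  by (simp add: cinner_scaleC_left flip: Re_cinner)

lemma cinner_eq_iff_inner:
  "cinner x y = cinner x' y' \<longleftrightarrow> inner x y = inner x' y' \<and> inner (\<i> *\<^sub>C x) y = inner (\<i> *\<^sub>C x') y'"
  for x :: "'a::complex_inner" and x' :: "'b::complex_inner"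
  by (simp add: complex_eq_iff Re_cinner Im_cinner)

lemma cinner_minus_left: "cinner (x - y) z = cinner x z - cinner y z" for x :: "'a::complex_inner"
  by (metis cinner_add_left diff_add_cancel eq_diff_eq)

lemma cinner_zero_left [simp]: "cinner 0 y = 0" for y :: "'a::complex_inner"
  by (metis cinner_minus_left diff_self)

lemma cinner_sum_left: "cinner (\<Sum>i\<in>I. f i) y = (\<Sum>i\<in>I. cinner (f i) y)" for y :: "'a::complex_inner"
  by (induction I rule: infinite_finite_induct) (simp_all add: cinner_add_left)

lemma cspan_scaleR: "x \<in> cspan B \<Longrightarrow> r *\<^sub>R x \<in> cspan B"
  by (metis complex_vector.span_scale scaleC_of_real)

lemma subspace_closure_cspan:
  fixes B :: "'a::complex_normed_vector set"
  shows "subspace (closure (cspan B))"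
proof (rule subspaceI)
  show "0 \<in> closure (cspan B)"
    using closure_subset complex_vector.span_zero by blast
next
  fix x y assume "x \<in> closure (cspan B)" "y \<in> closure (cspan B)"
  then obtain f g where "\<And>n. f n \<in> cspan B" "\<And>n. g n \<in> cspan B" "f \<longlonglongrightarrow> x" "g \<longlonglongrightarrow> y"
    unfolding closure_sequential by blast
  then have "\<And>n. f n + g n \<in> cspan B" "(\<lambda>n. f n + g n) \<longlonglongrightarrow> x + y"
    by (auto intro: complex_vector.span_add tendsto_add)
  then show "x + y \<in> closure (cspan B)"
    unfolding closure_sequential by (intro exI[of _ "\<lambda>n. f n + g n"]) auto
next
  fix r :: real and x assume "x \<in> closure (cspan B)"
  then obtain f where "\<And>n. f n \<in> cspan B" "f \<longlonglongrightarrow> x"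
    unfolding closure_sequential by blast
  then have "\<And>n. r *\<^sub>R f n \<in> cspan B" "(\<lambda>n. r *\<^sub>R f n) \<longlonglongrightarrow> r *\<^sub>R x"
    by (auto intro: cspan_scaleR tendsto_scaleR)
  then show "r *\<^sub>R x \<in> closure (cspan B)"
    unfolding closure_sequential by (intro exI[of _ "\<lambda>n. r *\<^sub>R f n"]) auto
qed

section \<open>Riesz representation, orthogonal projections, adjoints and orthonormal bases\<close>

text \<open>The representing vector minimises \<open>\<parallel>x\<parallel>\<^sup>2 - 2 f x\<close>. For \<open>f = inner y\<close> it is the orthogonal
  projection of \<open>y\<close> onto \<open>S\<close>.\<close>

lemma riesz_subspace:
  fixes f :: "'a::{real_inner, complete_space} \<Rightarrow> real"
  assumes S: "subspace S" "closed S" and f: "bounded_linear f"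
  obtains z where "z \<in> S" "\<And>x. x \<in> S \<Longrightarrow> inner z x = f x"
proof -
  interpret f: bounded_linear f by fact
  define J where "J x = (norm x)\<^sup>2 - 2 * f x" for x
  define m where "m = Inf (J ` S)"
  obtain K where K: "\<And>x. norm (f x) \<le> norm x * K"
    using f.bounded by blast
  have lower: "- K\<^sup>2 \<le> J x" for x
  proof -
    have "f x \<le> norm x * K"
      using K[of x] by simp
    moreover have "0 \<le> (norm x - K)\<^sup>2" by simp
    ultimately show ?thesis
      by (simp add: J_def power2_eq_square algebra_simps)
  qed
  then have bdd: "bdd_below (J ` S)" by (intro bdd_belowI[of _ "- K\<^sup>2"]) auto
  have ne: "S \<noteq> {}" using S subspace_0 by blast
  have m_le: "m \<le> J x" if "x \<in> S" for x
    unfolding m_def using bdd that by (intro cInf_lower) auto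
  have "\<exists>x\<in>S. J x < m + inverse (real (Suc n))" for n
  proof -
    have "m < m + inverse (real (Suc n))" by simp
    then show ?thesis
      unfolding m_def by (subst (asm) cInf_less_iff) (use bdd ne in auto)
  qed
  then obtain X where X: "\<And>n. X n \<in> S" "\<And>n. J (X n) < m + inverse (real (Suc n))"
    by metis
  \<comment> \<open>Parallelogram law: the linear part of \<open>J\<close> cancels in
    \<open>2 * J x + 2 * J y - 4 * J\<close> at the midpoint, and \<open>J\<close> is at least
    \<open>m\<close> there. Hence minimising sequences are Cauchy.\<close>
  have par: "(norm (x - y))\<^sup>2 \<le> 2 * (J x - m) + 2 * (J y - m)" if "x \<in> S" "y \<in> S" for x y
  proof -
    have "(1/2) *\<^sub>R (x + y) \<in> S"
      using S that by (intro subspace_scale subspace_add)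
    moreover have "(norm (x - y))\<^sup>2 = 2 * J x + 2 * J y - 4 * J ((1/2) *\<^sub>R (x + y))"
      by (simp add: J_def power2_norm_eq_inner f.add f.scaleR inner_commute algebra_simps)
    ultimately show ?thesis using m_le by fastforce
  qed
  have "Cauchy X"
  proof (rule metric_CauchyI)
    fix e :: real assume e: "e > 0"
    then have "0 < e\<^sup>2 / 4" by simp
    then obtain N where N: "inverse (real (Suc N)) < e\<^sup>2 / 4"
      using reals_Archimedean by blast
    have *: "J (X n) - m < e\<^sup>2 / 4" if "n \<ge> N" for n
    proof -
      have "inverse (real (Suc n)) \<le> inverse (real (Suc N))"
        using that by (simp add: field_simps)
      then show ?thesis using X(2)[of n] N by linarith
    qed
    have "dist (X i) (X j) < e" if "i \<ge> N" "j \<ge> N" for i j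
    proof -
      have "(norm (X i - X j))\<^sup>2 < e\<^sup>2"
        by (rule le_less_trans[OF par[OF X(1)[of i] X(1)[of j]]])
           (use *[OF that(1)] *[OF that(2)] in argo)
      then show ?thesis
        using e by (simp add: dist_norm power_less_imp_less_base)
    qed
    then show "\<exists>M. \<forall>i\<ge>M. \<forall>j\<ge>M. dist (X i) (X j) < e" by blast
  qed
  then obtain z where z: "X \<longlonglongrightarrow> z"
    using Cauchy_convergent convergent_def by blast
  have zS: "z \<in> S"
    using closed_sequentially[OF S(2) _ z] X(1) by blast
  have "(\<lambda>n. J (X n)) \<longlonglongrightarrow> J z"
    unfolding J_def by (intro tendsto_intros f.tendsto z)
  moreover have "(\<lambda>n. m + inverse (real (Suc n))) \<longlonglongrightarrow> m + 0"
    by (intro tendsto_intros LIMSEQ_inverse_real_of_nat)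
  ultimately have "J z \<le> m + 0"
    by (rule LIMSEQ_le) (use X(2) less_imp_le in blast)
  then have Jz: "J z \<le> m" by simp
  have "inner z v = f v" if v: "v \<in> S" for v
  proof -
    \<comment> \<open>First variation of \<open>J\<close> at its minimiser \<open>z\<close> in the
      direction \<open>v\<close>.\<close>
    have q: "0 \<le> 2 * t * (inner z v - f v) + t\<^sup>2 * (norm v)\<^sup>2" for t
    proof -
      have "z + t *\<^sub>R v \<in> S"
        using S zS v by (intro subspace_scale subspace_add)
      then have "J z \<le> J (z + t *\<^sub>R v)"
        using m_le Jz by fastforce
      then show ?thesis
        by (simp add: J_def power2_norm_eq_inner f.add f.scaleR inner_commute power2_eq_square[of t] algebra_simps)
    qed
    have "inner z v - f v = 0"
    proof (cases "v = 0")
      case True then show ?thesis by (simp add: f.zero)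
    next
      case False
      let ?d = "inner z v - f v" and ?n = "(norm v)\<^sup>2"
      have n: "?n > 0" using False by simp
      \<comment> \<open>This \<open>t\<close> minimises the quadratic, whose minimum is minus the
        square of \<open>?d\<close> divided by \<open>?n\<close>.\<close>
      have "0 \<le> 2 * (- ?d / ?n) * ?d + (- ?d / ?n)\<^sup>2 * ?n" by (rule q)
      also have "\<dots> = - (?d\<^sup>2 / ?n)"
        using n by (simp add: power2_eq_square divide_simps) (simp add: algebra_simps)
      finally have "?d\<^sup>2 / ?n \<le> 0" by simp
      then have "?d\<^sup>2 \<le> 0" using n by (simp add: divide_le_0_iff)
      then show ?thesis by simp
    qed
    then show ?thesis by simp
  qed
  with zS show ?thesis using that by blast
qed

lemma projection_exists:
  fixes x :: "'a::{real_inner, complete_space}"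
  assumes "subspace S" "closed S"
  obtains p where "p \<in> S" "\<And>v. v \<in> S \<Longrightarrow> inner v (x - p) = 0"
proof (rule riesz_subspace[OF assms bounded_linear_inner_right[of x]])
  fix z assume "z \<in> S" "\<And>v. v \<in> S \<Longrightarrow> inner z v = inner x v"
  then show thesis
    by (intro that[of z]) (auto simp: inner_diff_right inner_commute)
qed

lemma real_adjoint_exists:
  fixes A :: "'a::{real_inner, complete_space} \<Rightarrow>\<^sub>L 'b::real_inner"
  obtains B :: "'b \<Rightarrow>\<^sub>L 'a" where "\<And>x y. inner (A x) y = inner x (B y)"
proof -
  have "\<exists>z. \<forall>x. inner z x = inner (A x) y" for y
  proof (rule riesz_subspace[of UNIV "\<lambda>x. inner (A x) y"])
    show "bounded_linear (\<lambda>x. inner (A x) y)"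
      by (rule bounded_linear_inner_left_comp[OF blinfun.bounded_linear_right])
  qed auto
  then obtain b where b: "\<And>x y. inner (b y) x = inner (A x) y" by metis
  have "bounded_linear b"
  proof (rule bounded_linear_intro)
    show "b (x + y) = b x + b y" for x y
      by (subst vector_eq_rdot[symmetric]) (simp add: b inner_left_distrib inner_right_distrib)
    show "b (r *\<^sub>R x) = r *\<^sub>R b x" for r x
      by (subst vector_eq_rdot[symmetric]) (simp add: b)
    show "norm (b y) \<le> norm y * norm A" for y
    proof (cases "b y = 0")
      case False
      have "norm (b y) * norm (b y) = inner (A (b y)) y"
        by (simp flip: b add: power2_norm_eq_inner[symmetric] power2_eq_square[symmetric])
      also have "\<dots> \<le> norm (A (b y)) * norm y" by (rule norm_cauchy_schwarz)
      also have "\<dots> \<le> (norm A * norm (b y)) * norm y"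
        by (intro mult_right_mono norm_blinfun) auto
      finally show ?thesis using False by (simp add: ac_simps)
    qed auto
  qed
  then show ?thesis
    using that[of "Blinfun b"] by (simp add: bounded_linear_Blinfun_apply b inner_commute[of _ "b _"])
qed

text \<open>Justifies the definite description in \<open>cadjoint\<close>: complex linearity
  promotes the real adjoint to an adjoint for \<open>cinner\<close>, and the real part alone already
  determines it.\<close>

lemma cadjoint_inner:
  fixes A :: "'a::chilbert_space \<Rightarrow>\<^sub>L 'b::chilbert_space"
  assumes "clinear_op A"
  shows "inner (A x) y = inner x (cadjoint A y)"
proof -
  obtain B :: "'b \<Rightarrow>\<^sub>L 'a" where B: "\<And>x y. inner (A x) y = inner x (B y)"
    using real_adjoint_exists by blast
  have "cadjoint A = B" unfolding cadjoint_def
  proof (rule the_equality)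
    show "\<forall>x y. cinner (A x) y = cinner x (B y)"
      using assms by (simp add: cinner_eq_iff_inner B clinear_op_def)
         (metis B)
  next
    fix C :: "'b \<Rightarrow>\<^sub>L 'a" assume C: "\<forall>x y. cinner (A x) y = cinner x (C y)"
    show "C = B"
    proof (rule blinfun_eqI)
      fix y
      have "inner (C y) x = inner (B y) x" for x
        using C B[of x y] by (metis Re_cinner inner_commute)
      then show "C y = B y" by (metis vector_eq_rdot)
    qed
  qed
  then show ?thesis using B by simp
qed

text \<open>Gives meaning to the choice of basis in \<open>trace_norm\<close>. Zorn's lemma yields a
  maximal orthonormal set; if its closed span missed \<open>x\<close>, the normalised residual of
  the projection of \<open>x\<close> could be added.\<close>

lemma orthonormal_basis_exists: "\<exists>B :: 'a::chilbert_space set. orthonormal_basis B"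
proof -
  define \<O> where "\<O> = {B::'a set. \<forall>x\<in>B. \<forall>y\<in>B. cinner x y = (if x = y then 1 else 0)}"
  have "\<exists>M\<in>\<O>. \<forall>X\<in>\<O>. M \<subseteq> X \<longrightarrow> X = M"
  proof (rule subset_Zorn_nonempty)
    show "\<O> \<noteq> {}" by (auto simp: \<O>_def)
    fix C assume C: "C \<noteq> {}" "subset.chain \<O> C"
    show "\<Union>C \<in> \<O>" unfolding \<O>_def
    proof (clarify)
      fix x y X Y assume "x \<in> X" "X \<in> C" "y \<in> Y" "Y \<in> C"
      moreover from this have "X \<subseteq> Y \<or> Y \<subseteq> X"
        using C by (auto simp: subset_chain_def)
      moreover have "C \<subseteq> \<O>" using C by (auto simp: subset_chain_def)
      ultimately obtain Z where "x \<in> Z" "y \<in> Z" "Z \<in> \<O>" by blast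
      then show "cinner x y = (if x = y then 1 else 0)" by (simp add: \<O>_def)
    qed
  qed
  then obtain M where M: "M \<in> \<O>" and max: "\<And>X. X \<in> \<O> \<Longrightarrow> M \<subseteq> X \<Longrightarrow> X = M" by blast
  have "closure (cspan M) = UNIV"
  proof (rule ccontr)
    assume "closure (cspan M) \<noteq> UNIV"
    then obtain x where x: "x \<notin> closure (cspan M)" by blast
    obtain p where p: "p \<in> closure (cspan M)" "\<And>v. v \<in> closure (cspan M) \<Longrightarrow> inner v (x - p) = 0"
      using projection_exists[OF subspace_closure_cspan[of M] closed_closure, of x] by blast
    define y where "y = (1 / norm (x - p)) *\<^sub>R (x - p)"
    have ny: "norm y = 1" using p(1) x by (auto simp: y_def)
    then have yy: "cinner y y = 1" by (simp add: cinner_self)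
    have "inner v y = 0" if "v \<in> cspan M" for v
      using p(2) that closure_subset by (auto simp: y_def)
    \<comment> \<open>Real orthogonality to both \<open>v\<close> and
      \<open>\<i> *\<^sub>C v\<close> is complex orthogonality to \<open>v\<close>.\<close>
    then have my: "cinner v y = 0" if "v \<in> M" for v
      using that complex_vector.span_base[OF that] complex_vector.span_scale[of v M "\<i>"]
      by (simp add: complex_eq_iff Re_cinner Im_cinner)
    then have ym: "cinner y v = 0" if "v \<in> M" for v
      using that cinner_commute[of y v] by simp
    have "insert y M \<in> \<O>"
      using M yy my ym unfolding \<O>_def by auto
    from max[OF this] have "y \<in> M" by blast
    from my[OF this] yy show False by simp
  qed
  moreover have "\<forall>x\<in>M. \<forall>y\<in>M. cinner x y = (if x = y then 1 else 0)"
    using M unfolding \<O>_def by (rule CollectD)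
  ultimately show ?thesis unfolding orthonormal_basis_def by blast
qed

section \<open>Positive operators and the trace norm\<close>

lemma cadjoint_clinear:
  fixes A :: "'a::chilbert_space \<Rightarrow>\<^sub>L 'b::chilbert_space"
  assumes "clinear_op A"
  shows "clinear_op (cadjoint A)"
  unfolding clinear_op_def
proof (intro allI)
  fix c y
  have "inner x (cadjoint A (c *\<^sub>C y)) = inner x (c *\<^sub>C cadjoint A y)" for x
    using assms unfolding clinear_op_def
    by (metis cadjoint_inner[OF assms] inner_scaleC_right)
  then show "cadjoint A (c *\<^sub>C y) = c *\<^sub>C cadjoint A y"
    by (metis vector_eq_ldot)
qed

lemma inner_ii_self: "inner (\<i> *\<^sub>C x) x = 0" for x :: "'a::complex_inner"
  using cinner_self[of x] Im_cinner[of x x] by simp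

lemma positive_op_inner_nonneg:
  assumes "positive_op A"
  shows "0 \<le> inner (A x) x"
  using assms by (simp add: positive_op_def complex_nonneg_Reals_iff Re_cinner)

text \<open>Polarization. The quadratic form of \<open>A\<close> is real, so
  \<open>inner (\<i> *\<^sub>C A u) u\<close> vanishes for every \<open>u\<close>; expanding this at
  a sum \<open>u + y\<close> and taking \<open>u = - \<i> *\<^sub>C x\<close> gives
  symmetry.\<close>

lemma positive_op_symmetric:
  assumes "positive_op A"
  shows "inner (A x) y = inner x (A y)"
proof -
  have clin: "A (c *\<^sub>C u) = c *\<^sub>C A u" for c u
    using assms by (simp add: positive_op_def clinear_op_def)
  have zero: "inner (\<i> *\<^sub>C A u) u = 0" for u
  proof -
    have "Im (cinner (A u) u) = 0"
      using assms unfolding positive_op_def by (simp add: complex_nonneg_Reals_iff)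
    then show ?thesis by (simp add: Im_cinner)
  qed
  let ?x = "- \<i> *\<^sub>C x"
  have ix: "\<i> *\<^sub>C ?x = x"
    by (simp add: scaleC_scaleC scaleC_of_real[of 1, simplified])
  have "inner (\<i> *\<^sub>C A u) y + inner (\<i> *\<^sub>C A y) u = 0" for u
    using zero[of "u + y"] zero[of u] zero[of y]
    by (simp add: blinfun.add_right scaleC_add_right inner_add_left inner_add_right)
  then have "inner (\<i> *\<^sub>C A ?x) y + inner (\<i> *\<^sub>C A y) ?x = 0" .
  moreover have "\<i> *\<^sub>C A ?x = A x"
    by (metis clin ix)
  moreover have "inner (\<i> *\<^sub>C A y) ?x = - inner (A y) x"
    by (simp add: inner_scaleC_right scaleC_scaleC scaleC_of_real[of "-1", simplified])
  ultimately show ?thesis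
    by (simp add: inner_commute)
qed

text \<open>Evaluates the nonnegative form of \<open>A\<close> at \<open>x - t *\<^sub>R A x\<close>
  with \<open>t = 1 / norm A\<close>. It turns smallness of the form at \<open>x\<close> into
  smallness of \<open>A x\<close>, which the uniqueness of square roots needs.\<close>

lemma psd_norm_le:
  fixes A :: "'a::real_inner \<Rightarrow>\<^sub>L 'a"
  assumes sym: "\<And>x y. inner (A x) y = inner x (A y)" and pos: "\<And>x. 0 \<le> inner (A x) x"
  shows "(norm (A x))\<^sup>2 \<le> norm A * inner (A x) x"
proof (cases "norm A = 0")
  case False
  define t where "t = 1 / norm A"
  have t: "t * norm A = 1" "t > 0" using False by (auto simp: t_def)
  have "0 \<le> inner (A (x - t *\<^sub>R A x)) (x - t *\<^sub>R A x)" by (rule pos)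
  also have "\<dots> = inner (A x) x - 2 * t * (norm (A x))\<^sup>2 + t\<^sup>2 * inner (A (A x)) (A x)"
    by (simp add: blinfun.diff_right blinfun.scaleR_right inner_diff_left inner_diff_right
        power2_norm_eq_inner sym[of "A x" x] power2_eq_square[of t] algebra_simps)
  also have "inner (A (A x)) (A x) \<le> norm A * (norm (A x))\<^sup>2"
    using norm_cauchy_schwarz[of "A (A x)" "A x"]
      mult_right_mono[OF norm_blinfun[of A "A x"], of "norm (A x)"]
    by (simp add: power2_eq_square ac_simps)
  finally have "0 \<le> inner (A x) x - 2 * t * (norm (A x))\<^sup>2 + t\<^sup>2 * (norm A * (norm (A x))\<^sup>2)"
    using t(2) by (simp add: mult_left_mono)
  also have "t\<^sup>2 * (norm A * (norm (A x))\<^sup>2) = t * (norm (A x))\<^sup>2"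
    using t(1) by (simp add: power2_eq_square)
  finally have "t * (norm (A x))\<^sup>2 \<le> inner (A x) x" by simp
  then have "norm A * (t * (norm (A x))\<^sup>2) \<le> norm A * inner (A x) x"
    by (intro mult_left_mono) auto
  then show ?thesis using t(1) by (simp add: mult.assoc[symmetric] mult.commute)
qed simp

text \<open>With \<open>D = A - P\<close> one has \<open>A D = - D P\<close> and \<open>P D = - D A\<close>. On approximate eigenvectors \<open>x\<close>
  of \<open>D\<^sup>2\<close> for the eigenvalue \<open>\<parallel>D\<parallel>\<^sup>2\<close> this makes \<open>inner (A x) x\<close> and \<open>inner (P x) x\<close> small.\<close>

lemma positive_sqrt_unique:
  fixes A P :: "'a::real_inner \<Rightarrow>\<^sub>L 'a"
  assumes symA: "\<And>x y. inner (A x) y = inner x (A y)" and posA: "\<And>x. 0 \<le> inner (A x) x"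
    and symP: "\<And>x y. inner (P x) y = inner x (P y)" and posP: "\<And>x. 0 \<le> inner (P x) x"
    and eq: "A o\<^sub>L A = P o\<^sub>L P"
  shows "P = A"
proof (rule ccontr)
  assume "P \<noteq> A"
  define D where "D = A - P"
  define l where "l = norm D"
  have l: "l > 0" using \<open>P \<noteq> A\<close> by (simp add: l_def D_def)
  have eq': "A (A x) = P (P x)" for x
    using eq by (metis blinfun_apply_blinfun_compose)
  have D: "D x = A x - P x" for x by (simp add: D_def blinfun.diff_left)
  have symD: "inner (D x) y = inner x (D y)" for x y
    by (simp add: D inner_diff_left inner_diff_right symA symP)
  have AD: "A (D x) = - D (P x)" and PD: "P (D x) = - D (A x)" for x
    by (simp_all add: D blinfun.diff_right eq')
  \<comment> \<open>The pair \<open>T\<close>, \<open>S\<close> stands for \<open>A\<close>,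
    \<open>P\<close> and for \<open>P\<close>, \<open>A\<close>. The vector \<open>v\<close>
    measures how far \<open>x\<close> is from being an eigenvector of the square of
    \<open>D\<close>; the part of the form of \<open>T\<close> coming from \<open>D (D x)\<close> is
    nonpositive because \<open>S\<close> is positive.\<close>
  have key: "l\<^sup>2 * inner (T x) x \<le> norm T * (l * sqrt (l\<^sup>2 - (norm (D x))\<^sup>2))"
    if "\<And>x. T (D x) = - D (S x)" "\<And>x. 0 \<le> inner (S x) x" "norm x = 1" for T S :: "'a \<Rightarrow>\<^sub>L 'a" and x
  proof -
    define v where "v = D (D x) - l\<^sup>2 *\<^sub>R x"
    have Dx: "norm (D (D x)) \<le> l * norm (D x)" unfolding l_def by (rule norm_blinfun)
    have "(norm v)\<^sup>2 = (norm (D (D x)))\<^sup>2 - 2 * l\<^sup>2 * (norm (D x))\<^sup>2 + l\<^sup>2 * l\<^sup>2 * (norm x)\<^sup>2"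
      unfolding v_def power2_norm_eq_inner
      by (simp add: inner_diff_left inner_diff_right inner_commute[of x "D (D x)"] symD[of "D x" x] algebra_simps)
    also have "(norm (D (D x)))\<^sup>2 \<le> l\<^sup>2 * (norm (D x))\<^sup>2"
      using power_mono[OF Dx, of 2] by (simp add: power_mult_distrib)
    finally have "(norm v)\<^sup>2 \<le> l\<^sup>2 * (l\<^sup>2 - (norm (D x))\<^sup>2)"
      using that(3) by (simp add: algebra_simps)
    then have nv: "norm v \<le> l * sqrt (l\<^sup>2 - (norm (D x))\<^sup>2)"
      using l real_le_rsqrt[OF \<open>(norm v)\<^sup>2 \<le> _\<close>] by (simp add: real_sqrt_mult)
    have "inner (T (D (D x))) x = - inner (S (D x)) (D x)"
      by (simp add: that(1) symD)
    then have "inner (T (D (D x))) x \<le> 0" using that(2) by simp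
    moreover have "T (D (D x)) = T v + l\<^sup>2 *\<^sub>R T x"
      by (simp add: v_def blinfun.diff_right blinfun.scaleR_right)
    ultimately have "l\<^sup>2 * inner (T x) x \<le> - inner (T v) x"
      by (simp add: inner_add_left)
    also have "\<dots> \<le> norm (T v) * norm x"
      using norm_cauchy_schwarz[of "- T v" x] by simp
    also have "\<dots> \<le> norm T * norm v" using that(3) norm_blinfun[of T v] by simp
    also have "\<dots> \<le> norm T * (l * sqrt (l\<^sup>2 - (norm (D x))\<^sup>2))"
      by (intro mult_left_mono nv) auto
    finally show ?thesis .
  qed
  \<comment> \<open>Unit vectors on which \<open>D\<close> almost attains its norm
    \<open>l\<close>.\<close>
  have "\<exists>x. norm x = 1 \<and> l * (1 - inverse (real (Suc n))) < norm (D x)" for n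
  proof -
    define c where "c = l * (1 - inverse (real (Suc n)))"
    have c: "0 \<le> c" "c < l" using l by (auto simp: c_def field_simps)
    have "\<not> (\<forall>x. norm (D x) \<le> c * norm x)"
      using norm_blinfun_bound[of c D] c by (auto simp: l_def)
    then obtain y where y: "norm (D y) > c * norm y" by (auto simp: not_le)
    then have "y \<noteq> 0" using c by auto
    then have "norm (D ((1 / norm y) *\<^sub>R y)) > c" "norm ((1 / norm y) *\<^sub>R y) = 1"
      using y by (simp_all add: blinfun.scaleR_right field_simps)
    then show ?thesis unfolding c_def by blast
  qed
  then obtain X where X: "\<And>n. norm (X n) = 1" "\<And>n. l * (1 - inverse (real (Suc n))) < norm (D (X n))"
    by metis
  have DX: "(\<lambda>n. norm (D (X n))) \<longlonglongrightarrow> l"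
  proof (rule tendsto_sandwich)
    have "(\<lambda>n. l * (1 - inverse (real (Suc n)))) \<longlonglongrightarrow> l * (1 - 0)"
      by (intro tendsto_intros LIMSEQ_inverse_real_of_nat)
    then show "(\<lambda>n. l * (1 - inverse (real (Suc n)))) \<longlonglongrightarrow> l" by simp
    show "\<forall>\<^sub>F n in sequentially. norm (D (X n)) \<le> l"
    proof (intro always_eventually allI)
      show "norm (D (X n)) \<le> l" for n
        using norm_blinfun[of D "X n"] X(1)[of n] by (simp add: l_def)
    qed
    show "\<forall>\<^sub>F n in sequentially. l * (1 - inverse (real (Suc n))) \<le> norm (D (X n))"
      by (intro always_eventually allI less_imp_le X(2))
  qed simp
  have lim: "(\<lambda>n. T (X n)) \<longlonglongrightarrow> 0"
    if "\<And>x. T (D x) = - D (S x)" "\<And>x. 0 \<le> inner (S x) x"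
      "\<And>x y. inner (T x) y = inner x (T y)" "\<And>x. 0 \<le> inner (T x) x" for T S :: "'a \<Rightarrow>\<^sub>L 'a"
  proof -
    have "(\<lambda>n. norm T * (norm T * (l * sqrt (l\<^sup>2 - (norm (D (X n)))\<^sup>2)) / l\<^sup>2)) \<longlonglongrightarrow>
        norm T * (norm T * (l * sqrt (l\<^sup>2 - l\<^sup>2)) / l\<^sup>2)"
      using l by (intro tendsto_intros DX) auto
    then have lim0: "(\<lambda>n. norm T * (norm T * (l * sqrt (l\<^sup>2 - (norm (D (X n)))\<^sup>2)) / l\<^sup>2)) \<longlonglongrightarrow> 0"
      by simp
    have "(norm (T (X n)))\<^sup>2 \<le> norm T * (norm T * (l * sqrt (l\<^sup>2 - (norm (D (X n)))\<^sup>2)) / l\<^sup>2)" for n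
    proof -
      have "inner (T (X n)) (X n) \<le> norm T * (l * sqrt (l\<^sup>2 - (norm (D (X n)))\<^sup>2)) / l\<^sup>2"
        using key[OF that(1,2) X(1)[of n]] l by (simp add: field_simps)
      then show ?thesis
        by (meson mult_left_mono norm_ge_zero order_trans psd_norm_le[OF that(3,4)])
    qed
    then have "(\<lambda>n. (norm (T (X n)))\<^sup>2) \<longlonglongrightarrow> 0"
      by (intro tendsto_sandwich[OF _ _ tendsto_const lim0] eventuallyI) auto
    then have "(\<lambda>n. sqrt ((norm (T (X n)))\<^sup>2)) \<longlonglongrightarrow> sqrt 0"
      by (rule tendsto_real_sqrt)
    then show ?thesis by (simp add: tendsto_norm_zero_iff)
  qed
  \<comment> \<open>Both \<open>A (X n)\<close> and \<open>P (X n)\<close> tend to zero, hence so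
    does their difference \<open>D (X n)\<close>, whose norm however tends to
    \<open>l > 0\<close>.\<close>
  have "(\<lambda>n. D (X n)) \<longlonglongrightarrow> 0 - 0"
    unfolding D
    by (intro tendsto_diff lim[OF AD posP symA posA] lim[OF PD posA symP posP])
  then have "(\<lambda>n. norm (D (X n))) \<longlonglongrightarrow> 0" by (simp add: tendsto_norm_zero)
  with DX l show False using LIMSEQ_unique by blast
qed

text \<open>A positive operator is self-adjoint, so it is a positive square root of
  \<open>cadjoint A o\<^sub>L A\<close>; uniqueness of such roots resolves the definite description
  in \<open>abs_op\<close>.\<close>

lemma abs_op_positive:
  assumes "positive_op A"
  shows "abs_op A = A"
proof -
  have "inner (cadjoint A x) y = inner (A x) y" for x y
    using assms by (metis positive_op_def cadjoint_inner positive_op_symmetric inner_commute)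
  then have adj: "cadjoint A = A"
    by (intro blinfun_eqI) (metis vector_eq_rdot)
  show ?thesis unfolding abs_op_def adj
  proof (rule the_equality)
    fix P assume P: "positive_op P \<and> P o\<^sub>L P = A o\<^sub>L A"
    show "P = A"
      by (rule positive_sqrt_unique)
         (use P assms in \<open>auto intro: positive_op_symmetric positive_op_inner_nonneg\<close>)
  qed (use assms in simp)
qed

text \<open>The defect operator of a contraction is positive, so it is its own modulus and its
  diagonal entries are the summands in the hypothesis. Assuming the bound for all finite orthonormal
  sets covers whichever basis \<open>trace_norm\<close> selects.\<close>

lemma trace_norm_defect_le:
  fixes T :: "'a::chilbert_space \<Rightarrow>\<^sub>L 'b::chilbert_space"
  assumes T: "clinear_op T" and contr: "\<And>x. norm (T x) \<le> norm x"
    and sum: "\<And>E. finite E \<Longrightarrow> (\<forall>x\<in>E. \<forall>y\<in>E. cinner x y = (if x = y then 1 else 0)) \<Longrightarrow>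
      (\<Sum>e\<in>E. (norm e)\<^sup>2 - (norm (T e))\<^sup>2) \<le> K"
  shows "trace_norm (id_blinfun - (cadjoint T o\<^sub>L T)) \<le> ennreal K"
proof -
  define A where "A = id_blinfun - (cadjoint T o\<^sub>L T)"
  have A: "A x = x - cadjoint T (T x)" for x
    by (simp add: A_def blinfun.diff_left)
  have inn: "inner (A x) y = inner x y - inner (T x) (T y)" for x y
    by (metis A inner_diff_left inner_commute cadjoint_inner[OF T])
  have lin: "clinear_op A"
    using T cadjoint_clinear[OF T]
    by (simp add: clinear_op_def A complex_vector.scale_right_diff_distrib)
  have re: "Re (cinner (A x) x) = (norm x)\<^sup>2 - (norm (T x))\<^sup>2" for x
    by (simp add: Re_cinner inn power2_norm_eq_inner)
  have im: "Im (cinner (A x) x) = 0" for x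
  proof -
    have "Im (cinner (A x) x) = - inner (A (\<i> *\<^sub>C x)) x"
      using lin by (simp add: Im_cinner clinear_op_def)
    also have "\<dots> = 0"
      using T by (simp add: inn clinear_op_def inner_ii_self)
    finally show ?thesis .
  qed
  have "positive_op A"
    unfolding positive_op_def complex_nonneg_Reals_iff
    using lin re im contr by (simp add: power_mono)
  then have abs: "abs_op A = A" by (rule abs_op_positive)
  define B :: "'a set" where "B = (SOME B. orthonormal_basis B)"
  have B: "orthonormal_basis B"
    unfolding B_def using orthonormal_basis_exists by (rule someI_ex)
  have "trace_norm A = (\<Sum>\<^sub>\<infinity>e\<in>B. ennreal ((norm e)\<^sup>2 - (norm (T e))\<^sup>2))"
    by (simp add: trace_norm_def B_def abs re)
  also have "\<dots> \<le> ennreal K"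
  proof (rule infsum_le_finite_sums)
    fix E assume E: "finite E" "E \<subseteq> B"
    have "(\<Sum>e\<in>E. ennreal ((norm e)\<^sup>2 - (norm (T e))\<^sup>2)) = ennreal (\<Sum>e\<in>E. (norm e)\<^sup>2 - (norm (T e))\<^sup>2)"
      using contr by (intro sum_ennreal) (simp add: power_mono)
    also have "\<dots> \<le> ennreal K"
      using B E by (intro ennreal_leI sum) (auto simp: orthonormal_basis_def subset_iff)
    finally show "(\<Sum>e\<in>E. ennreal ((norm e)\<^sup>2 - (norm (T e))\<^sup>2)) \<le> ennreal K" .
  qed (simp add: nonneg_summable_on_complete)
  finally show ?thesis by (simp add: A_def)
qed

section \<open>Operators of finite rank\<close>

lemma norm_sum_orthonormal:
  fixes C :: "'a::complex_inner set"
  assumes "finite C" "\<forall>x\<in>C. \<forall>y\<in>C. cinner x y = (if x = y then 1 else 0)"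
  shows "(norm (\<Sum>c\<in>C. a c *\<^sub>C c))\<^sup>2 = (\<Sum>c\<in>C. (cmod (a c))\<^sup>2)"
    and "d \<in> C \<Longrightarrow> cinner (\<Sum>c\<in>C. a c *\<^sub>C c) d = a d"
proof -
  let ?y = "\<Sum>c\<in>C. a c *\<^sub>C c"
  show coeff: "cinner ?y d = a d" if "d \<in> C" for d
  proof -
    have "cinner ?y d = (\<Sum>c\<in>C. if c = d then a c else 0)"
      unfolding cinner_sum_left by (intro sum.cong) (use assms that in \<open>auto simp: cinner_scaleC_left\<close>)
    then show ?thesis using that assms(1) by simp
  qed
  have "cinner ?y ?y = (\<Sum>c\<in>C. a c * cinner c ?y)"
    by (subst cinner_sum_left) (simp add: cinner_scaleC_left)
  also have "\<dots> = (\<Sum>c\<in>C. complex_of_real ((cmod (a c))\<^sup>2))"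
  proof (intro sum.cong refl)
    fix c assume "c \<in> C"
    then have "cinner c ?y = cnj (a c)"
      using coeff cinner_commute by metis
    then show "a c * cinner c ?y = complex_of_real ((cmod (a c))\<^sup>2)"
      by (metis complex_norm_square)
  qed
  finally have "complex_of_real ((norm ?y)\<^sup>2) = complex_of_real (\<Sum>c\<in>C. (cmod (a c))\<^sup>2)"
    by (simp add: cinner_self)
  then show "(norm ?y)\<^sup>2 = (\<Sum>c\<in>C. (cmod (a c))\<^sup>2)"
    using of_real_eq_iff by blast
qed

text \<open>Each new vector contributes its normalised residual, or nothing when it already lies in
  the span. Only inclusion of spans and a cardinality bound are recorded, which is all that a rank
  estimate requires.\<close>

lemma gram_schmidt:
  fixes B :: "'a::complex_inner set"
  assumes "finite B"
  obtains C where "finite C" "card C \<le> card B" "cspan B \<subseteq> cspan C"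
    "\<forall>x\<in>C. \<forall>y\<in>C. cinner x y = (if x = y then 1 else 0)"
  using assms
proof (induction B arbitrary: thesis rule: finite_induct)
  case empty
  show ?case by (rule empty[of "{}"]) auto
next
  case (insert b B)
  obtain C where C: "finite C" "card C \<le> card B" "cspan B \<subseteq> cspan C"
    and on: "\<forall>x\<in>C. \<forall>y\<in>C. cinner x y = (if x = y then 1 else 0)"
    by (rule insert.IH)
  define p where "p = (\<Sum>c\<in>C. cinner b c *\<^sub>C c)"
  define q where "q = (1 / norm (b - p)) *\<^sub>R (b - p)"
  have p: "p \<in> cspan C"
    unfolding p_def
    by (intro complex_vector.span_sum complex_vector.span_scale complex_vector.span_base)
  have card: "Suc (card C) \<le> card (insert b B)" using C insert.hyps by simp
  show ?case
  proof (cases "b = p")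
    case True
    then have "insert b B \<subseteq> cspan C"
      using p C(3) complex_vector.span_superset by blast
    then have "cspan (insert b B) \<subseteq> cspan C"
      by (metis complex_vector.span_minimal complex_vector.subspace_span)
    then show ?thesis using insert.prems[of C] C on card by simp
  next
    case False
    have "cinner (b - p) c = 0" if "c \<in> C" for c
      using norm_sum_orthonormal(2)[OF C(1) on that] by (simp add: cinner_minus_left p_def)
    then have qc: "cinner q c = 0" if "c \<in> C" for c
      using that by (simp add: q_def cinner_scaleC_left flip: scaleC_of_real)
    then have cq: "cinner c q = 0" if "c \<in> C" for c
      using that cinner_commute[of c q] by simp
    have "norm q = 1" using False by (simp add: q_def)
    then have qq: "cinner q q = 1" by (simp add: cinner_self)
    have on': "\<forall>x\<in>insert q C. \<forall>y\<in>insert q C. cinner x y = (if x = y then 1 else 0)"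
      using on qc cq qq by auto
    have "norm (b - p) *\<^sub>R q \<in> cspan (insert q C)"
      by (intro cspan_scaleR complex_vector.span_base) simp
    moreover have sub: "cspan C \<subseteq> cspan (insert q C)"
      by (intro complex_vector.span_mono) auto
    ultimately have "norm (b - p) *\<^sub>R q + p \<in> cspan (insert q C)"
      using p by (intro complex_vector.span_add) auto
    then have "b \<in> cspan (insert q C)" using False by (simp add: q_def)
    then have "insert b B \<subseteq> cspan (insert q C)"
      using sub C(3) complex_vector.span_superset by blast
    then have "cspan (insert b B) \<subseteq> cspan (insert q C)"
      by (metis complex_vector.span_minimal complex_vector.subspace_span)
    then show ?thesis
      using insert.prems[of "insert q C"] C(1) on' card card_insert_le_m1
      by (metis card_insert_if finite_insert le_trans le_SucI order_refl)
  qed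
qed

text \<open>The squared Hilbert-Schmidt norm is at most the rank times the squared operator norm.
  Expand \<open>S e\<close> in an orthonormal set spanning the range and exchange the sums; each
  coordinate then contributes at most \<open>(norm S)\<^sup>2\<close> by Bessel's
  inequality.\<close>

lemma sum_norm_finite_rank:
  fixes S :: "'a::complex_inner \<Rightarrow>\<^sub>L 'b::complex_inner"
  assumes S: "clinear_op S" and B: "finite B" "range S \<subseteq> cspan B"
    and E: "finite E" "\<forall>x\<in>E. \<forall>y\<in>E. cinner x y = (if x = y then 1 else 0)"
  shows "(\<Sum>e\<in>E. (norm (S e))\<^sup>2) \<le> real (card B) * (norm S)\<^sup>2"
proof -
  obtain C where C: "finite C" "card C \<le> card B" "cspan B \<subseteq> cspan C"
    and on: "\<forall>x\<in>C. \<forall>y\<in>C. cinner x y = (if x = y then 1 else 0)"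
    by (rule gram_schmidt[OF B(1)])
  have expand: "(norm (S x))\<^sup>2 = (\<Sum>c\<in>C. (cmod (cinner (S x) c))\<^sup>2)" for x
  proof -
    have "S x \<in> cspan C" using B(2) C(3) by auto
    then obtain a where a: "S x = (\<Sum>c\<in>C. a c *\<^sub>C c)"
      unfolding complex_vector.span_finite[OF C(1)] by blast
    show ?thesis
      unfolding a norm_sum_orthonormal(1)[OF C(1) on]
      by (intro sum.cong refl) (simp add: norm_sum_orthonormal(2)[OF C(1) on])
  qed
  have "(\<Sum>e\<in>E. (cmod (cinner (S e) c))\<^sup>2) \<le> (norm S)\<^sup>2" if c: "c \<in> C" for c
  proof -
    define L where "L x = cinner (S x) c" for x
    \<comment> \<open>The extremal vector for the functional \<open>L\<close> on the span of
      \<open>E\<close>: \<open>L x\<close> and the squared norm of \<open>x\<close> both equal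
      \<open>s\<close>, so \<open>s\<close> is at most \<open>norm S\<close> times the square root
      of \<open>s\<close>.\<close>
    define x where "x = (\<Sum>e\<in>E. cnj (L e) *\<^sub>C e)"
    define s where "s = (\<Sum>e\<in>E. (cmod (L e))\<^sup>2)"
    have s0: "0 \<le> s" unfolding s_def by (intro sum_nonneg) auto
    have nx: "(norm x)\<^sup>2 = s"
      unfolding x_def norm_sum_orthonormal(1)[OF E] s_def by simp
    have "S x = (\<Sum>e\<in>E. cnj (L e) *\<^sub>C S e)"
      unfolding x_def blinfun.sum_right using S by (simp add: clinear_op_def)
    then have "L x = (\<Sum>e\<in>E. cnj (L e) * L e)"
      by (simp add: L_def cinner_sum_left cinner_scaleC_left)
    also have "\<dots> = complex_of_real s"
      unfolding s_def of_real_sum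
      by (intro sum.cong refl) (metis complex_norm_square mult.commute of_real_power)
    finally have "s = inner (S x) c"
      unfolding L_def by (metis Re_cinner Re_complex_of_real)
    also have "\<dots> \<le> norm (S x) * norm c" by (rule norm_cauchy_schwarz)
    also have "norm c = 1"
    proof -
      have "cinner c c = 1" using on c by simp
      then have "(norm c)\<^sup>2 = 1"
        using Re_cinner[of c c] by (simp add: power2_norm_eq_inner)
      then show ?thesis using power2_eq_iff_nonneg[of "norm c" 1] by simp
    qed
    finally have "s \<le> norm S * norm x"
      using norm_blinfun[of S x] by simp
    then have "s\<^sup>2 \<le> (norm S * norm x)\<^sup>2" using s0 by (rule power_mono)
    then have "s * s \<le> (norm S)\<^sup>2 * s" by (simp add: power_mult_distrib nx power2_eq_square[of s])
    then have "s \<le> (norm S)\<^sup>2" using s0 by (cases "s = 0") auto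
    then show ?thesis by (simp add: s_def L_def)
  qed
  then have "(\<Sum>c\<in>C. \<Sum>e\<in>E. (cmod (cinner (S e) c))\<^sup>2) \<le> real (card C) * (norm S)\<^sup>2"
    by (intro sum_bounded_above)
  also have "\<dots> \<le> real (card B) * (norm S)\<^sup>2"
    using C(2) by (intro mult_right_mono) auto
  finally show ?thesis
    unfolding expand by (subst sum.swap)
qed

section \<open>Stability of the rank of idempotents, and its propagation over the disk\<close>

text \<open>\<open>P\<close> is injective on the range of \<open>Q\<close>: if \<open>Q x = x\<close> and \<open>P x = 0\<close>, then \<open>x = (Q - P) x\<close>.\<close>

lemma idempotent_range_le:
  fixes P Q :: "'a::complex_normed_vector \<Rightarrow>\<^sub>L 'a"
  assumes P: "clinear_op P" "range P \<subseteq> cspan B" "finite B" "card B \<le> n"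
    and Q: "clinear_op Q" "Q o\<^sub>L Q = Q" and close: "norm (Q - P) < 1"
  shows "\<exists>C. range Q \<subseteq> cspan C \<and> finite C \<and> card C \<le> n"
proof -
  interpret P: Vector_Spaces.linear "scaleC :: complex \<Rightarrow> 'a \<Rightarrow> 'a" "scaleC :: complex \<Rightarrow> 'a \<Rightarrow> 'a" P
    using P(1) by unfold_locales (auto simp: clinear_op_def blinfun.add_right)
  interpret Q: Vector_Spaces.linear "scaleC :: complex \<Rightarrow> 'a \<Rightarrow> 'a" "scaleC :: complex \<Rightarrow> 'a \<Rightarrow> 'a" Q
    using Q(1) by unfold_locales (auto simp: clinear_op_def blinfun.add_right)
  obtain C where C: "C \<subseteq> range Q" "complex_vector.independent C" "range Q \<subseteq> cspan C"
    by (rule complex_vector.maximal_independent_subset)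
  have sub: "complex_vector.subspace (range Q)"
    using Q.subspace_image[OF complex_vector.subspace_UNIV] by simp
  have span: "cspan C = range Q"
    using complex_vector.span_minimal[OF C(1) sub] C(3) by blast
  have "inj_on P (range Q)"
    unfolding P.inj_on_iff_eq_0[OF sub]
  proof (intro ballI impI)
    fix x assume x: "x \<in> range Q" "P x = 0"
    have "Q x = x" using x(1) Q(2) by (metis blinfun_apply_blinfun_compose imageE)
    then have "norm x = norm ((Q - P) x)" using x(2) by (simp add: blinfun.diff_left)
    also have "\<dots> \<le> norm (Q - P) * norm x" by (rule norm_blinfun)
    finally have "0 \<le> (norm (Q - P) - 1) * norm x" by (simp add: algebra_simps)
    then show "x = 0" using close by (simp add: zero_le_mult_iff)
  qed
  then have inj: "inj_on P (cspan C)" unfolding span .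
  moreover have "inj_on P C" using inj complex_vector.span_superset inj_on_subset by blast
  ultimately have ind: "complex_vector.independent (P ` C)" "card (P ` C) = card C" "finite (P ` C) = finite C"
    using P.independent_injective_image[OF C(2), folded cspan_def] by (auto simp: card_image finite_image_iff)
  \<comment> \<open>Finiteness of the basis \<open>C\<close> of \<open>range Q\<close> is obtained
    only here: its injective image is independent inside the span of \<open>card B\<close>
    vectors.\<close>
  have "P ` C \<subseteq> cspan B" using P(2) by auto
  then have "finite (P ` C) \<and> card (P ` C) \<le> card B"
    by (rule complex_vector.independent_span_bound[OF P(3) ind(1)])
  then show ?thesis using C(3) ind(2,3) P(4) by (intro exI[of _ C]) simp
qed

text \<open>The sets where \<open>R\<close> holds and where it fails are both open in the connected
  disk. This carries a rank bound from one point to all others.\<close>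

lemma locally_constant_on_disk:
  assumes z0: "z0 \<in> unit_disk" "R z0"
    and loc: "\<And>z. z \<in> unit_disk \<Longrightarrow> \<exists>d>0. \<forall>w\<in>unit_disk. dist w z < d \<longrightarrow> R w = R z"
    and z: "z \<in> unit_disk"
  shows "R z"
proof -
  have open_R: "openin (top_of_set unit_disk) {z \<in> unit_disk. R z = b}" for b
    unfolding openin_euclidean_subtopology_iff
  proof (intro conjI ballI)
    fix z assume "z \<in> {z \<in> unit_disk. R z = b}"
    with loc[of z] show "\<exists>e>0. \<forall>w\<in>unit_disk. dist w z < e \<longrightarrow> w \<in> {z \<in> unit_disk. R z = b}"
      by auto
  qed auto
  have "{z \<in> unit_disk. R z = True} \<inter> {z \<in> unit_disk. R z = False} = {}"
       "unit_disk \<subseteq> {z \<in> unit_disk. R z = True} \<union> {z \<in> unit_disk. R z = False}"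
    by auto
  moreover have "connected unit_disk" by (rule connected_ball)
  ultimately have "{z \<in> unit_disk. R z = True} = {} \<or> {z \<in> unit_disk. R z = False} = {}"
    using open_R unfolding connected_openin by blast
  then show ?thesis using z0 z by blast
qed

section \<open>Analytic functions on the disk\<close>

text \<open>The differentiability clause of \<open>H_infty\<close> in isolation, so that it also
  applies to vector-valued functions.\<close>

definition disk_analytic :: "(complex \<Rightarrow> 'a::complex_normed_vector) \<Rightarrow> bool" where
  "disk_analytic f \<longleftrightarrow> (\<forall>z\<in>unit_disk. \<exists>D. has_complex_derivative f D z)"

lemma tendsto_scaleC:
  fixes g :: "'b \<Rightarrow> 'a::complex_normed_vector"
  assumes "(f \<longlongrightarrow> c) X" "(g \<longlongrightarrow> x) X"
  shows "((\<lambda>w. f w *\<^sub>C g w) \<longlongrightarrow> c *\<^sub>C x) X"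
proof -
  have "((\<lambda>w. cmod (f w) * norm (g w - x) + cmod (f w - c) * norm x) \<longlongrightarrow> cmod c * 0 + 0 * norm x) X"
    by (intro tendsto_add tendsto_mult tendsto_norm tendsto_const assms tendsto_norm_zero
        LIM_zero[OF assms(1)] LIM_zero[OF assms(2)])
  then have "((\<lambda>w. cmod (f w) * norm (g w - x) + cmod (f w - c) * norm x) \<longlongrightarrow> 0) X" by simp
  then have "((\<lambda>w. f w *\<^sub>C g w - c *\<^sub>C x) \<longlongrightarrow> 0) X"
  proof (rule Lim_null_comparison[rotated])
    show "\<forall>\<^sub>F w in X. norm (f w *\<^sub>C g w - c *\<^sub>C x) \<le> cmod (f w) * norm (g w - x) + cmod (f w - c) * norm x"
    proof (intro always_eventually allI)
      fix w
      have "f w *\<^sub>C g w - c *\<^sub>C x = f w *\<^sub>C (g w - x) + (f w - c) *\<^sub>C x"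
        by (simp add: complex_vector.scale_right_diff_distrib complex_vector.scale_left_diff_distrib)
      then show "norm (f w *\<^sub>C g w - c *\<^sub>C x) \<le> cmod (f w) * norm (g w - x) + cmod (f w - c) * norm x"
        by (metis norm_scaleC norm_triangle_ineq)
    qed
  qed
  then show ?thesis by (rule LIM_zero_cancel)
qed

lemma has_complex_derivative_tendsto:
  assumes "has_complex_derivative f D z"
  shows "(f \<longlongrightarrow> f z) (at z)"
proof -
  have "((\<lambda>w. (w - z) *\<^sub>C inverse (w - z) *\<^sub>C (f w - f z)) \<longlongrightarrow> (z - z) *\<^sub>C D) (at z)"
    using assms unfolding has_complex_derivative_def
    by (intro tendsto_scaleC tendsto_intros)
  moreover have "\<forall>\<^sub>F w in at z. (w - z) *\<^sub>C inverse (w - z) *\<^sub>C (f w - f z) = f w - f z"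
    by (auto simp: eventually_at_filter scaleC_scaleC intro!: always_eventually)
  ultimately have "((\<lambda>w. f w - f z) \<longlongrightarrow> 0) (at z)"
    by (auto dest: tendsto_cong)
  then show ?thesis by (rule LIM_zero_cancel)
qed

lemma disk_analytic_continuous_on: "disk_analytic f \<Longrightarrow> continuous_on unit_disk f"
  unfolding disk_analytic_def
  by (intro continuous_at_imp_continuous_on ballI)
     (auto simp: continuous_at dest!: bspec has_complex_derivative_tendsto)

text \<open>Product rule. Complex linearity of \<open>F z\<close> is what moves the factor
  \<open>inverse (w - z)\<close> through it.\<close>

lemma disk_analytic_apply:
  fixes F :: "complex \<Rightarrow> 'a::complex_normed_vector \<Rightarrow>\<^sub>L 'b::complex_normed_vector"
  assumes F: "disk_analytic F" "\<forall>z\<in>unit_disk. clinear_op (F z)" and v: "disk_analytic v"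
  shows "disk_analytic (\<lambda>z. F z (v z))"
  unfolding disk_analytic_def
proof
  fix z assume z: "z \<in> unit_disk"
  obtain D E where D: "has_complex_derivative F D z" and E: "has_complex_derivative v E z"
    using F v z unfolding disk_analytic_def by blast
  have "((\<lambda>w. (inverse (w - z) *\<^sub>C (F w - F z)) (v w) + F z (inverse (w - z) *\<^sub>C (v w - v z)))
      \<longlongrightarrow> D (v z) + F z E) (at z)"
    using D E has_complex_derivative_tendsto[OF E] unfolding has_complex_derivative_def
    by (intro tendsto_add blinfun.tendsto tendsto_const)
  moreover have "(inverse (w - z) *\<^sub>C (F w - F z)) (v w) + F z (inverse (w - z) *\<^sub>C (v w - v z))
      = inverse (w - z) *\<^sub>C (F w (v w) - F z (v z))" for w
    using F(2) z
    by (simp add: clinear_op_def scaleC_blinfun.rep_eq blinfun.diff_left blinfun.diff_right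
        flip: scaleC_add_right)
  ultimately have "has_complex_derivative (\<lambda>z. F z (v z)) (D (v z) + F z E) z"
    unfolding has_complex_derivative_def by simp
  then show "\<exists>D. has_complex_derivative (\<lambda>z. F z (v z)) D z" by blast
qed

lemma disk_analytic_const: "disk_analytic (\<lambda>z. c)"
  unfolding disk_analytic_def has_complex_derivative_def by (auto intro!: exI[of _ 0])

lemma disk_analytic_diff_const: "disk_analytic v \<Longrightarrow> disk_analytic (\<lambda>z. v z - c)"
  unfolding disk_analytic_def has_complex_derivative_def by simp

text \<open>Weak analyticity: it reduces mean values of vector-valued functions to Cauchy's formula
  for scalar ones.\<close>

lemma disk_analytic_cinner:
  fixes v :: "complex \<Rightarrow> 'a::complex_inner"
  assumes "disk_analytic v"
  shows "(\<lambda>z. cinner (v z) y) holomorphic_on unit_disk"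
proof (rule holomorphic_onI)
  fix z assume z: "z \<in> unit_disk"
  obtain D where D: "((\<lambda>w. inverse (w - z) *\<^sub>C (v w - v z)) \<longlongrightarrow> D) (at z)"
    using assms z unfolding disk_analytic_def has_complex_derivative_def by blast
  have cin: "cinner x y = Complex (inner x y) (- inner (\<i> *\<^sub>C x) y)" for x
    by (simp add: complex_eq_iff Re_cinner Im_cinner)
  have "((\<lambda>w. cinner (inverse (w - z) *\<^sub>C (v w - v z)) y) \<longlongrightarrow> cinner D y) (at z)"
    unfolding cin
    by (intro tendsto_Complex tendsto_minus tendsto_inner tendsto_const tendsto_scaleC D)
  then have "((\<lambda>w. (cinner (v w) y - cinner (v z) y) / (w - z)) \<longlongrightarrow> cinner D y) (at z)"
    by (simp add: cinner_scaleC_left cinner_minus_left divide_inverse mult.commute)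
  then have "((\<lambda>z. cinner (v z) y) has_field_derivative cinner D y) (at z)"
    by (simp add: has_field_derivative_iff)
  then show "(\<lambda>z. cinner (v z) y) field_differentiable at z within unit_disk"
    by (meson field_differentiable_at_within field_differentiable_def)
qed

section \<open>The Poisson measure\<close>

definition poisson_kernel :: "complex \<Rightarrow> real \<Rightarrow> real" where
  "poisson_kernel a t = (1 - (cmod a)\<^sup>2) / (2 * pi * (cmod (cis t - a))\<^sup>2)"

text \<open>Harmonic measure of the disk at \<open>a\<close> in the angle variable. The closed
  interval represents the point 1 twice, which is a null set.\<close>

definition poisson_measure :: "complex \<Rightarrow> real measure" where
  "poisson_measure a = density lborel (\<lambda>t. ennreal (indicator {0..2 * pi} t * poisson_kernel a t))"

lemma poisson_kernel_nonneg: "a \<in> unit_disk \<Longrightarrow> 0 \<le> poisson_kernel a t"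
  by (simp add: poisson_kernel_def power_le_one)

lemma continuous_poisson_kernel:
  assumes "a \<in> unit_disk"
  shows "continuous_on S (poisson_kernel a)"
proof -
  have "cis t \<noteq> a" for t using assms by auto
  then show ?thesis unfolding poisson_kernel_def by (intro continuous_intros) auto
qed

lemma sets_poisson_measure [measurable_cong, simp]: "sets (poisson_measure a) = sets borel"
  and space_poisson_measure [simp]: "space (poisson_measure a) = UNIV"
  by (simp_all add: poisson_measure_def)

lemma measurable_poisson_density:
  assumes "a \<in> unit_disk"
  shows "(\<lambda>t. indicator {0..2 * pi} t * poisson_kernel a t) \<in> borel_measurable borel"
  using borel_measurable_continuous_onI[OF continuous_poisson_kernel[OF assms, of UNIV]]
  by measurable

text \<open>Links the Lebesgue integral, used for dominated convergence, with the gauge integral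
  produced by contour integration.\<close>

lemma integral_poisson_measure:
  fixes h :: "real \<Rightarrow> real"
  assumes a: "a \<in> unit_disk" and h: "continuous_on UNIV h"
  shows "integrable (poisson_measure a) h"
    and "(\<integral>t. h t \<partial>poisson_measure a) = integral {0..2 * pi} (\<lambda>t. poisson_kernel a t * h t)"
proof -
  note [measurable] = measurable_poisson_density[OF a] borel_measurable_continuous_onI[OF h]
  have "continuous_on {0..2 * pi} (\<lambda>t. poisson_kernel a t * h t)"
    by (intro continuous_on_mult continuous_poisson_kernel a continuous_on_subset[OF h]) auto
  then have si: "set_integrable lborel {0..2 * pi} (\<lambda>t. poisson_kernel a t * h t)"
    by (rule borel_integrable_atLeastAtMost')
  have nn: "AE t in lborel. 0 \<le> indicator {0..2 * pi} t * poisson_kernel a t"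
    using poisson_kernel_nonneg[OF a] by simp
  show "integrable (poisson_measure a) h"
    using si nn unfolding poisson_measure_def set_integrable_def
    by (subst integrable_density) (auto simp: mult.assoc)
  have "(\<integral>t. h t \<partial>poisson_measure a) = (LINT t:{0..2*pi}|lborel. poisson_kernel a t * h t)"
    unfolding poisson_measure_def set_lebesgue_integral_def
    by (subst integral_density) (use nn in \<open>auto simp: mult.assoc\<close>)
  then show "(\<integral>t. h t \<partial>poisson_measure a) = integral {0..2 * pi} (\<lambda>t. poisson_kernel a t * h t)"
    using set_borel_integral_eq_integral(2)[OF si] by simp
qed

lemma finite_poisson_measure:
  assumes a: "a \<in> unit_disk"
  shows "finite_measure (poisson_measure a)"
proof
  have "integrable (poisson_measure a) (\<lambda>t. 1 :: real)"
    by (intro integral_poisson_measure a continuous_intros)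
  then show "emeasure (poisson_measure a) (space (poisson_measure a)) \<noteq> \<infinity>"
    by (simp add: integrable_iff_bounded)
qed

text \<open>Cauchy's formula at \<open>a\<close> for \<open>g (of_real r * z)\<close> multiplied by
  a factor that equals 1 at \<open>a\<close> and turns the Cauchy kernel on the circle into the
  Poisson kernel. Since \<open>r < 1\<close>, the product is holomorphic on the closed disk.\<close>

lemma poisson_mean_value:
  assumes a: "a \<in> unit_disk" and r: "0 \<le> r" "r < 1" and g: "g holomorphic_on unit_disk"
  shows "(\<integral>t. Re (g (of_real r * cis t)) \<partial>poisson_measure a) = Re (g (of_real r * a))"
proof -
  have na: "cmod a < 1" using a by simp
  have in_disk: "of_real r * z \<in> unit_disk" if "z \<in> cball 0 1" for z
  proof -
    have "cmod (of_real r * z) \<le> r" using that r by (simp add: norm_mult mult_left_le)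
    then show ?thesis using r by simp
  qed
  have ne: "1 - cnj a * z \<noteq> 0" if "z \<in> cball 0 1" for z
  proof
    assume "1 - cnj a * z = 0"
    then have "cmod (cnj a * z) = 1" by simp
    moreover have "cmod (cnj a * z) \<le> cmod a"
      using that by (simp add: norm_mult mult_left_le)
    ultimately show False using na by simp
  qed
  \<comment> \<open>Used with \<open>z = cis t\<close>, \<open>d = cis t - a\<close>,
    \<open>e\<close> the conjugate of \<open>d\<close>, \<open>k\<close> the numerator of the
    Poisson kernel, and \<open>w\<close> the value of \<open>g\<close>.\<close>
  have alg: "1 / (2 * p * \<i>) * (w * k / (z * e) / d * \<i> * z) = k / (2 * p * (d * e)) * w"
    if "z \<noteq> 0" "d \<noteq> 0" "e \<noteq> 0" "p \<noteq> 0" for z d e p w k :: complex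
    using that by (simp add: field_simps)
  define G where "G z = g (of_real r * z) * of_real (1 - (cmod a)\<^sup>2) / (1 - cnj a * z)" for z
  have comp: "(\<lambda>z. g (of_real r * z)) holomorphic_on S" if "S \<subseteq> cball 0 1" for S
  proof -
    have "(g \<circ> (\<lambda>z. of_real r * z)) holomorphic_on S"
      by (intro holomorphic_on_compose_gen[OF _ g] holomorphic_intros) (use in_disk that in blast)
    then show ?thesis by (simp add: o_def)
  qed
  have hol: "G holomorphic_on cball 0 1"
    unfolding G_def by (intro holomorphic_intros comp ne) auto
  have "((\<lambda>u. G u / (u - a)) has_contour_integral (2 * of_real pi * \<i> * G a)) (circlepath 0 1)"
    by (intro Cauchy_integral_circlepath_simple hol) (use na in simp)
  then have "((\<lambda>t. G (cis t) / (cis t - a) * \<i> * cis t) has_integral (2 * of_real pi * \<i> * G a)) {0..2*pi}"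
    unfolding circlepath_def by (subst (asm) has_contour_integral_part_circlepath_iff) auto
  then have "((\<lambda>t. 1 / (2 * of_real pi * \<i>) * (G (cis t) / (cis t - a) * \<i> * cis t))
      has_integral 1 / (2 * of_real pi * \<i>) * (2 * of_real pi * \<i> * G a)) {0..2*pi}"
    by (rule has_integral_mult_right)
  moreover have "1 / (2 * of_real pi * \<i>) * (2 * of_real pi * \<i> * G a) = g (of_real r * a)"
  proof -
    have "1 - cnj a * a = of_real (1 - (cmod a)\<^sup>2)"
      by (simp add: complex_norm_square mult.commute flip: of_real_power)
    moreover have "1 - cnj a * a \<noteq> 0" using na by (intro ne) simp
    ultimately show ?thesis by (simp add: G_def)
  qed
  moreover have "1 / (2 * of_real pi * \<i>) * (G (cis t) / (cis t - a) * \<i> * cis t)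
      = of_real (poisson_kernel a t) * g (of_real r * cis t)" for t
  proof -
    have ca: "cis t - a \<noteq> 0" using na by auto
    have "cis t * cnj (cis t) = 1" by (simp add: cis_cnj cis_mult)
    then have c: "1 - cnj a * cis t = cis t * cnj (cis t - a)"
      by (simp add: algebra_simps)
    have n: "of_real ((cmod (cis t - a))\<^sup>2) = (cis t - a) * cnj (cis t - a)"
      by (rule complex_norm_square)
    show ?thesis
      unfolding G_def poisson_kernel_def c of_real_divide of_real_mult of_real_numeral n
      by (rule alg) (use ca in \<open>simp_all add: complex_cnj_cancel_iff\<close>)
  qed
  ultimately have "((\<lambda>t. of_real (poisson_kernel a t) * g (of_real r * cis t)) has_integral g (of_real r * a)) {0..2*pi}"
    by simp
  from has_integral_linear[OF this bounded_linear_Re]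
  have "((\<lambda>t. poisson_kernel a t * Re (g (of_real r * cis t))) has_integral Re (g (of_real r * a))) {0..2*pi}"
    by (simp add: o_def)
  then have "integral {0..2*pi} (\<lambda>t. poisson_kernel a t * Re (g (of_real r * cis t))) = Re (g (of_real r * a))"
    by (rule integral_unique)
  moreover have "continuous_on UNIV (\<lambda>t. Re (g (of_real r * cis t)))"
    by (intro continuous_intros continuous_on_compose2[OF holomorphic_on_imp_continuous_on[OF g]])
       (use in_disk in auto)
  ultimately show ?thesis using integral_poisson_measure(2)[OF a] by simp
qed

lemma poisson_mean_value_inner:
  fixes v :: "complex \<Rightarrow> 'a::complex_inner"
  assumes "a \<in> unit_disk" "0 \<le> r" "r < 1" "disk_analytic v"
  shows "(\<integral>t. inner (v (of_real r * cis t)) y \<partial>poisson_measure a) = inner (v (of_real r * a)) y"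
  using poisson_mean_value[OF assms(1-3) disk_analytic_cinner[OF assms(4)]] by (simp add: Re_cinner)

lemma measure_poisson_measure:
  assumes "a \<in> unit_disk"
  shows "measure (poisson_measure a) UNIV = 1"
  using poisson_mean_value[of a 0 "\<lambda>z. 1"] assms by simp

text \<open>Harmonic measure is absolutely continuous with respect to \<open>circle_measure\<close>.
  The angle \<open>2 * pi\<close>, absent from the half-open interval there, is a null set.\<close>

lemma AE_poisson_measure:
  assumes a: "a \<in> unit_disk" and P: "AE \<zeta> in circle_measure. P \<zeta>"
  shows "AE t in poisson_measure a. P (cis t)"
proof -
  have "cis \<in> borel_measurable borel"
    by (intro borel_measurable_continuous_onI continuous_intros)
  moreover have "measurable (uniform_measure lborel {0..<2 * pi}) borel = measurable borel (borel :: complex measure)"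
    by (rule measurable_cong_sets) simp_all
  ultimately have "cis \<in> measurable (uniform_measure lborel {0..<2 * pi}) (restrict_space borel unit_circle)"
    by (intro measurable_restrict_space2) auto
  then have "AE t in uniform_measure lborel {0..<2 * pi}. P (cis t)"
    using P unfolding circle_measure_def by (rule AE_distrD)
  then have "AE t in lborel. t \<in> {0..<2 * pi} \<longrightarrow> P (cis t)"
    by (subst (asm) AE_uniform_measure) auto
  moreover have "AE t in lborel. t \<noteq> 2 * pi" by (rule AE_lborel_singleton)
  ultimately have "AE t in lborel. 0 < ennreal (indicator {0..2 * pi} t * poisson_kernel a t) \<longrightarrow> P (cis t)"
    by eventually_elim (auto simp: indicator_def split: if_splits)
  then show ?thesis
    unfolding poisson_measure_def
    using measurable_poisson_density[OF a] by (subst AE_density) auto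
qed

text \<open>The radius ending at \<open>\<zeta>\<close> stays in the region of aperture 2, because
  the distance from \<open>r n * \<zeta>\<close> to \<open>\<zeta>\<close> is exactly
  \<open>1 - r n\<close>.\<close>

lemma has_boundary_value_radial:
  assumes "has_boundary_value F A \<zeta>" "cmod \<zeta> = 1"
    and r: "\<And>n. 0 \<le> r n" "\<And>n. r n < 1" "r \<longlonglongrightarrow> (1 :: real)"
  shows "(\<lambda>n. F (of_real (r n) * \<zeta>) x) \<longlonglongrightarrow> A x"
proof -
  have lim: "((\<lambda>z. F z x) \<longlongrightarrow> A x) (at \<zeta> within stolz_region 2 \<zeta>)"
    using assms(1) unfolding has_boundary_value_def by simp
  have "filterlim (\<lambda>n. of_real (r n) * \<zeta>) (at \<zeta> within stolz_region 2 \<zeta>) sequentially"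
    unfolding filterlim_at
  proof
    have "(\<lambda>n. of_real (r n) * \<zeta>) \<longlonglongrightarrow> of_real 1 * \<zeta>"
      by (intro tendsto_intros r)
    then show "(\<lambda>n. of_real (r n) * \<zeta>) \<longlonglongrightarrow> \<zeta>" by simp
    show "\<forall>\<^sub>F n in sequentially. of_real (r n) * \<zeta> \<in> stolz_region 2 \<zeta> \<and> of_real (r n) * \<zeta> \<noteq> \<zeta>"
    proof (intro always_eventually allI)
      fix n
      have "of_real (r n) * \<zeta> - \<zeta> = of_real (r n - 1) * \<zeta>" by (simp add: algebra_simps)
      then have "cmod (of_real (r n) * \<zeta> - \<zeta>) = 1 - r n"
        using r(2)[of n] assms(2) by (simp only: norm_mult norm_of_real) simp
      moreover have "cmod (of_real (r n) * \<zeta>) = r n"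
        using r(1)[of n] assms(2) by (simp add: norm_mult)
      ultimately show "of_real (r n) * \<zeta> \<in> stolz_region 2 \<zeta> \<and> of_real (r n) * \<zeta> \<noteq> \<zeta>"
        using r(2)[of n] by (auto simp: stolz_region_def)
    qed
  qed
  from filterlim_compose[OF lim this] show ?thesis .
qed

section \<open>Left invertible inner functions\<close>

text \<open>Cauchy-Schwarz for the positive semidefinite form
  \<open>inner x y - inner (T x) (T y)\<close>, with its value at \<open>y\<close> bounded by the
  squared norm of \<open>y\<close>.\<close>

lemma contraction_inner_le:
  fixes T :: "'a::real_inner \<Rightarrow>\<^sub>L 'b::real_inner"
  assumes contr: "\<And>x. norm (T x) \<le> norm x"
  shows "inner (T x) (T y) \<le> inner x y + norm y * sqrt ((norm x)\<^sup>2 - (norm (T x))\<^sup>2)"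
proof (cases "y = 0")
  case False
  define b where "b = inner x y - inner (T x) (T y)"
  define d where "d = (norm x)\<^sup>2 - (norm (T x))\<^sup>2"
  define n where "n = (norm y)\<^sup>2"
  have n: "n > 0" using False by (simp add: n_def)
  \<comment> \<open>The minimiser of \<open>d + 2 * t * b + t\<^sup>2 * n\<close>.\<close>
  define t where "t = - b / n"
  have "(norm (T (x + t *\<^sub>R y)))\<^sup>2 \<le> (norm (x + t *\<^sub>R y))\<^sup>2"
    by (intro power_mono contr) simp
  moreover have "(norm (x + t *\<^sub>R y))\<^sup>2 = (norm x)\<^sup>2 + 2 * t * inner x y + t\<^sup>2 * n"
    by (simp add: n_def power2_norm_eq_inner inner_add_left inner_add_right inner_commute[of y x]
        power2_eq_square[of t] algebra_simps)
  moreover have "(norm (T (x + t *\<^sub>R y)))\<^sup>2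
      = (norm (T x))\<^sup>2 + 2 * t * inner (T x) (T y) + t\<^sup>2 * (norm (T y))\<^sup>2"
    by (simp add: power2_norm_eq_inner inner_add_left inner_add_right inner_commute[of "T y" "T x"]
        blinfun.add_right blinfun.scaleR_right power2_eq_square[of t] algebra_simps)
  moreover have "0 \<le> t\<^sup>2 * (norm (T y))\<^sup>2" by simp
  ultimately have "0 \<le> d + 2 * t * b + t\<^sup>2 * n"
    unfolding b_def d_def right_diff_distrib by linarith
  also have "\<dots> = d - b\<^sup>2 / n"
    using n by (simp add: t_def power2_eq_square divide_simps)
  finally have "b\<^sup>2 \<le> n * d" using n by (simp add: field_simps)
  then have "\<bar>b\<bar> \<le> sqrt (n * d)" by (metis real_sqrt_abs real_sqrt_le_mono)
  also have "\<dots> = norm y * sqrt d" by (simp add: n_def real_sqrt_mult)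
  finally show ?thesis unfolding b_def d_def by linarith
qed simp

text \<open>With \<open>u = T x\<close>, \<open>h = u - u\<^sub>0\<close> and \<open>k = S h\<close> one has \<open>h = T k - (u\<^sub>0 - T (S u\<^sub>0))\<close>, and
  \<open>inner u (T k)\<close> differs from \<open>inner x k\<close> only by the isometry defect of \<open>T\<close>.\<close>

lemma left_inverse_estimate:
  fixes T :: "'a::real_inner \<Rightarrow>\<^sub>L 'b::real_inner" and S :: "'b \<Rightarrow>\<^sub>L 'a"
  assumes contr: "\<And>x. norm (T x) \<le> norm x" and ST: "\<And>x. S (T x) = x"
  shows "(norm (T x))\<^sup>2 \<le> 2 * inner (T x) u\<^sub>0 - (norm u\<^sub>0)\<^sup>2
    + 2 * inner (S (T x - u\<^sub>0)) x - 2 * inner (T (S (T x - u\<^sub>0))) u\<^sub>0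
    + 2 * (norm (S (T x - u\<^sub>0)) * sqrt ((norm x)\<^sup>2 - (norm (T x))\<^sup>2))
    + (norm (u\<^sub>0 - T (S u\<^sub>0)))\<^sup>2"
proof -
  define h where "h = T x - u\<^sub>0"
  define k where "k = S h"
  define q where "q = u\<^sub>0 - T (S u\<^sub>0)"
  have hk: "h = T k - q"
    by (simp add: k_def h_def q_def blinfun.diff_right ST)
  have "(norm h)\<^sup>2 = inner h (T k) - inner h q"
    by (metis hk inner_diff_right power2_norm_eq_inner)
  also have "inner h (T k) = inner (T x) (T k) - inner (T k) u\<^sub>0"
    by (simp add: h_def inner_diff_left inner_commute[of _ u\<^sub>0])
  also have "inner (T x) (T k) \<le> inner k x + norm k * sqrt ((norm x)\<^sup>2 - (norm (T x))\<^sup>2)"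
    using contraction_inner_le[OF contr, of x k] by (simp add: inner_commute)
  finally have "(norm h)\<^sup>2 \<le> inner k x + norm k * sqrt ((norm x)\<^sup>2 - (norm (T x))\<^sup>2)
      - inner (T k) u\<^sub>0 - inner h q" by simp
  \<comment> \<open>Bounds twice the cross term \<open>- inner h q\<close> by the squared norms of
    \<open>h\<close> and \<open>q\<close>. Absorbing the former in the doubled inequality leaves
    \<open>q\<close> with coefficient 1 and produces the factors 2.\<close>
  moreover have "0 \<le> (norm (h + q))\<^sup>2" by simp
  then have "0 \<le> (norm h)\<^sup>2 + 2 * inner h q + (norm q)\<^sup>2"
    by (simp add: power2_norm_eq_inner inner_add_left inner_add_right inner_commute)
  moreover have "(norm h)\<^sup>2 = (norm (T x))\<^sup>2 - 2 * inner (T x) u\<^sub>0 + (norm u\<^sub>0)\<^sup>2"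
    by (simp add: h_def power2_norm_eq_inner inner_diff_left inner_diff_right inner_commute)
  ultimately show ?thesis unfolding h_def[symmetric] k_def[symmetric] q_def[symmetric] by linarith
qed

lemma disk_scale:
  assumes "0 \<le> r" "r < 1" "z \<in> cball 0 1"
  shows "of_real r * z \<in> unit_disk"
proof -
  have "cmod (of_real r * z) \<le> r" using assms by (simp add: norm_mult mult_left_le)
  then show ?thesis using assms by simp
qed

lemma continuous_on_circle:
  assumes "continuous_on unit_disk v" "0 \<le> r" "r < 1"
  shows "continuous_on S (\<lambda>t. v (of_real r * cis t))"
  by (intro continuous_on_compose2[OF assms(1)] continuous_intros) (use assms in \<open>auto intro: disk_scale simp del: mem_ball\<close>)

section \<open>Averages over the circles of radius \<open>r n\<close>, for a fixed inner function
  and a fixed left inverse\<close>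

context
  fixes F :: "complex \<Rightarrow> 'e::chilbert_space \<Rightarrow>\<^sub>L 'f::chilbert_space"
    and G :: "complex \<Rightarrow> 'f \<Rightarrow>\<^sub>L 'e"
    and r :: "nat \<Rightarrow> real" and C D :: real
  assumes F: "disk_analytic F" "\<forall>z\<in>unit_disk. clinear_op (F z)" "\<And>z. z \<in> unit_disk \<Longrightarrow> norm (F z) \<le> C"
    and G: "disk_analytic G" "\<forall>z\<in>unit_disk. clinear_op (G z)" "\<And>z. z \<in> unit_disk \<Longrightarrow> norm (G z) \<le> D"
    and inner: "inner_function F"
    and GF: "\<And>z x. z \<in> unit_disk \<Longrightarrow> G z (F z x) = x"
    and r: "\<And>n. 0 \<le> r n" "\<And>n. r n < 1" "r \<longlonglongrightarrow> 1"
begin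

lemma bound_nonneg: "0 \<le> C" "0 \<le> D"
  using order_trans[OF norm_ge_zero F(3)[of 0]] order_trans[OF norm_ge_zero G(3)[of 0]] by auto

lemma circle_in_disk: "of_real (r n) * cis t \<in> unit_disk"
  by (intro disk_scale r) simp

lemma scaled_in_disk: "a \<in> unit_disk \<Longrightarrow> of_real (r n) * a \<in> unit_disk"
  by (intro disk_scale r) simp

lemma norm_F_apply: "z \<in> unit_disk \<Longrightarrow> norm (F z x) \<le> C * norm x"
  by (rule order_trans[OF norm_blinfun mult_right_mono[OF F(3)]]) auto

lemma norm_G_apply: "z \<in> unit_disk \<Longrightarrow> norm (G z x) \<le> D * norm x"
  by (rule order_trans[OF norm_blinfun mult_right_mono[OF G(3)]]) auto

lemma analytic_F: "disk_analytic (\<lambda>z. F z x)"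
  by (rule disk_analytic_apply[OF F(1,2) disk_analytic_const])

lemma F_radial: "a \<in> unit_disk \<Longrightarrow> (\<lambda>n. F (of_real (r n) * a) x) \<longlonglongrightarrow> F a x"
proof (rule continuous_on_tendsto_compose[OF disk_analytic_continuous_on[OF analytic_F]])
  assume a: "a \<in> unit_disk"
  show "\<forall>\<^sub>F n in sequentially. of_real (r n) * a \<in> unit_disk"
    by (intro always_eventually allI scaled_in_disk a)
  have "(\<lambda>n. of_real (r n) * a) \<longlonglongrightarrow> of_real 1 * a" by (intro tendsto_intros r)
  then show "(\<lambda>n. of_real (r n) * a) \<longlonglongrightarrow> a" by simp
qed simp

text \<open>Dominated convergence, with the isometric boundary values supplying the pointwise limit.
  The function \<open>\<phi>\<close> is left general because both the squared norm and the square
  root of the isometry defect are needed.\<close>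

lemma boundary_integral:
  assumes a: "a \<in> unit_disk" and \<phi>: "continuous_on UNIV \<phi>"
  shows "(\<lambda>n. \<integral>t. \<phi> (norm (F (of_real (r n) * cis t) x)) \<partial>poisson_measure a) \<longlonglongrightarrow> (\<phi> (norm x) :: real)"
proof -
  interpret finite_measure "poisson_measure a" by (rule finite_poisson_measure[OF a])
  have cont: "continuous_on UNIV (\<lambda>t. \<phi> (norm (F (of_real (r n) * cis t) x)))" for n
    by (intro continuous_on_compose2[OF \<phi>] continuous_on_norm
        continuous_on_circle[OF disk_analytic_continuous_on[OF analytic_F]] r) auto
  \<comment> \<open>The maximum of the norm of \<open>\<phi>\<close> on this interval dominates all
    the integrands, as the norms involved stay below \<open>C * norm x\<close>.\<close>
  have "compact (\<phi> ` {0..C * norm x})"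
    by (intro compact_continuous_image continuous_on_subset[OF \<phi>]) auto
  then have "bounded (\<phi> ` {0..C * norm x})" by (rule compact_imp_bounded)
  then obtain K where "\<forall>y\<in>\<phi> ` {0..C * norm x}. norm y \<le> K"
    unfolding bounded_iff by (elim exE)
  then have K: "norm (\<phi> s) \<le> K" if "s \<in> {0..C * norm x}" for s
    using imageI[OF that, of \<phi>] by (rule bspec)
  have lim: "AE t in poisson_measure a.
      (\<lambda>n. \<phi> (norm (F (of_real (r n) * cis t) x))) \<longlonglongrightarrow> \<phi> (norm x)"
  proof -
    have "AE t in poisson_measure a. \<exists>A. has_boundary_value F A (cis t) \<and> isometry A"
      using inner unfolding inner_function_def by (rule AE_poisson_measure[OF a])
    then show ?thesis
    proof eventually_elim
      case (elim t)
      then obtain A where A: "has_boundary_value F A (cis t)" "isometry A" by blast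
      have "(\<lambda>n. F (of_real (r n) * cis t) x) \<longlonglongrightarrow> A x"
        by (rule has_boundary_value_radial[OF A(1) _ r]) simp
      from tendsto_norm[OF this]
      have "(\<lambda>n. norm (F (of_real (r n) * cis t) x)) \<longlonglongrightarrow> norm x"
        using A(2) unfolding isometry_def by simp
      then show ?case
        by (rule continuous_on_tendsto_compose[OF \<phi>]) auto
    qed
  qed
  have "(\<lambda>n. \<integral>t. \<phi> (norm (F (of_real (r n) * cis t) x)) \<partial>poisson_measure a)
      \<longlonglongrightarrow> (\<integral>t. \<phi> (norm x) \<partial>poisson_measure a)"
  proof (rule integral_dominated_convergence[where w = "\<lambda>_. K"])
    show "(\<lambda>t. \<phi> (norm (F (of_real (r n) * cis t) x))) \<in> borel_measurable (poisson_measure a)" for n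
      using borel_measurable_continuous_onI[OF cont] by simp
    show "AE t in poisson_measure a. norm (\<phi> (norm (F (of_real (r n) * cis t) x))) \<le> K" for n
      using norm_F_apply[OF circle_in_disk] by (intro always_eventually allI K) simp
  qed (use lim in auto)
  then show ?thesis using measure_poisson_measure[OF a] by simp
qed

text \<open>By the mean value property, the average of the squared distance to the value at
  \<open>r n * a\<close> is a variance. Its nonnegativity bounds that value by the average squared
  norm, which tends to the squared norm of \<open>x\<close>.\<close>

lemma norm_F_le:
  assumes a: "a \<in> unit_disk"
  shows "norm (F a x) \<le> norm x"
proof -
  have "(norm (F (of_real (r n) * a) x))\<^sup>2 \<le> (\<integral>t. (norm (F (of_real (r n) * cis t) x))\<^sup>2 \<partial>poisson_measure a)" for n
  proof -
    define u\<^sub>0 where "u\<^sub>0 = F (of_real (r n) * a) x"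
    let ?u = "\<lambda>t. F (of_real (r n) * cis t) x"
    have cu: "continuous_on UNIV ?u"
      by (intro continuous_on_circle[OF disk_analytic_continuous_on[OF analytic_F]] r)
    have i: "integrable (poisson_measure a) (\<lambda>t. inner (?u t) u\<^sub>0)"
      by (intro integral_poisson_measure(1)[OF a] continuous_on_inner cu continuous_on_const)
    have c: "integrable (poisson_measure a) (\<lambda>t. c :: real)" for c
      by (intro integral_poisson_measure(1)[OF a] continuous_on_const)
    have "(\<integral>t. inner (?u t) u\<^sub>0 \<partial>poisson_measure a) = (norm u\<^sub>0)\<^sup>2"
      using poisson_mean_value_inner[OF a r(1,2) analytic_F] by (simp add: u\<^sub>0_def power2_norm_eq_inner)
    then have "(norm u\<^sub>0)\<^sup>2 = (\<integral>t. 2 * inner (?u t) u\<^sub>0 - (norm u\<^sub>0)\<^sup>2 \<partial>poisson_measure a)"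
      using i c by (simp add: measure_poisson_measure[OF a])
    also have "\<dots> \<le> (\<integral>t. (norm (?u t))\<^sup>2 \<partial>poisson_measure a)"
    proof (rule integral_mono)
      show "integrable (poisson_measure a) (\<lambda>t. (norm (?u t))\<^sup>2)"
        by (intro integral_poisson_measure(1)[OF a] continuous_on_power continuous_on_norm cu)
      show "2 * inner (?u t) u\<^sub>0 - (norm u\<^sub>0)\<^sup>2 \<le> (norm (?u t))\<^sup>2" for t
      proof -
        have "0 \<le> (norm (?u t - u\<^sub>0))\<^sup>2" by simp
        also have "\<dots> = (norm (?u t))\<^sup>2 - 2 * inner (?u t) u\<^sub>0 + (norm u\<^sub>0)\<^sup>2"
          by (simp add: power2_norm_eq_inner inner_diff_left inner_diff_right inner_commute)
        finally show ?thesis by simp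
      qed
    qed (use i c in auto)
    finally show ?thesis unfolding u\<^sub>0_def .
  qed
  moreover have "(\<lambda>n. \<integral>t. (norm (F (of_real (r n) * cis t) x))\<^sup>2 \<partial>poisson_measure a) \<longlonglongrightarrow> (norm x)\<^sup>2"
    by (rule boundary_integral[OF a, of "\<lambda>s. s\<^sup>2"]) (intro continuous_intros)
  moreover have "(\<lambda>n. (norm (F (of_real (r n) * a) x))\<^sup>2) \<longlonglongrightarrow> (norm (F a x))\<^sup>2"
    by (intro tendsto_intros F_radial a)
  ultimately have "(norm (F a x))\<^sup>2 \<le> (norm x)\<^sup>2"
    by (blast intro: LIMSEQ_le)
  then show ?thesis by (rule power2_le_imp_le) simp
qed

text \<open>Integrates \<open>left_inverse_estimate\<close> over the circle. The function
  \<open>k\<close> vanishes at \<open>r n * a\<close>, so the two terms containing it have mean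
  zero; there remain the isometry defect and the complementary part \<open>q\<close>.\<close>

lemma radial_estimate:
  assumes a: "a \<in> unit_disk"
  shows "(\<integral>t. (norm (F (of_real (r n) * cis t) x))\<^sup>2 \<partial>poisson_measure a) - (norm (F (of_real (r n) * a) x))\<^sup>2
    \<le> 4 * D * norm x * (\<integral>t. sqrt ((norm x)\<^sup>2 - (norm (F (of_real (r n) * cis t) x))\<^sup>2) \<partial>poisson_measure a)
      + (\<integral>t. (norm ((id_blinfun - (F (of_real (r n) * cis t) o\<^sub>L G (of_real (r n) * cis t))) (F (of_real (r n) * a) x)))\<^sup>2
          \<partial>poisson_measure a)"
proof -
  define u\<^sub>0 where "u\<^sub>0 = F (of_real (r n) * a) x"
  define z where "z t = of_real (r n) * cis t" for t
  define k where "k w = G w (F w x - u\<^sub>0)" for w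
  define q where "q w = u\<^sub>0 - F w (G w u\<^sub>0)" for w
  have z: "z t \<in> unit_disk" for t unfolding z_def by (rule circle_in_disk)
  have an_k: "disk_analytic k"
    unfolding k_def by (intro disk_analytic_apply[OF G(1,2)] disk_analytic_diff_const analytic_F)
  have an_Fk: "disk_analytic (\<lambda>w. F w (k w))"
    by (rule disk_analytic_apply[OF F(1,2) an_k])
  have an_FG: "disk_analytic (\<lambda>w. F w (G w u\<^sub>0))"
    by (intro disk_analytic_apply[OF F(1,2)] disk_analytic_apply[OF G(1,2)] disk_analytic_const)
  have k0: "k (of_real (r n) * a) = 0" by (simp add: k_def u\<^sub>0_def)
  have cont: "continuous_on UNIV (\<lambda>t. v (z t))" if "disk_analytic v" for v :: "complex \<Rightarrow> 'b::complex_normed_vector"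
    unfolding z_def by (intro continuous_on_circle disk_analytic_continuous_on that r)
  note conts = cont[OF analytic_F] cont[OF an_k] cont[OF an_Fk] cont[OF an_FG]
  have mean: "(\<integral>t. inner (v (z t)) y \<partial>poisson_measure a) = inner (v (of_real (r n) * a)) y"
    if "disk_analytic v" for v :: "complex \<Rightarrow> 'b::complex_inner" and y
    unfolding z_def by (rule poisson_mean_value_inner[OF a r(1,2) that])
  note int = integral_poisson_measure(1)[OF a]
  let ?s = "\<lambda>t. sqrt ((norm x)\<^sup>2 - (norm (F (z t) x))\<^sup>2)"
  have i1: "integrable (poisson_measure a) (\<lambda>t. inner (F (z t) x) u\<^sub>0)"
    and i2: "integrable (poisson_measure a) (\<lambda>t. inner (k (z t)) x)"
    and i3: "integrable (poisson_measure a) (\<lambda>t. inner (F (z t) (k (z t))) u\<^sub>0)"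
    and i4: "integrable (poisson_measure a) ?s"
    and i5: "integrable (poisson_measure a) (\<lambda>t. (norm (q (z t)))\<^sup>2)"
    and i6: "integrable (poisson_measure a) (\<lambda>t. (norm (F (z t) x))\<^sup>2)"
    and i7: "integrable (poisson_measure a) (\<lambda>t. c :: real)" for c
    unfolding q_def
    by (intro int continuous_on_inner continuous_on_const continuous_on_real_sqrt continuous_on_diff
        continuous_on_power continuous_on_norm conts)+
  \<comment> \<open>\<open>F\<close> is contractive, so \<open>F w x - u\<^sub>0\<close> has norm at
    most \<open>2 * norm x\<close>; doubled once more by the pointwise estimate, this gives the
    constant \<open>4 * D\<close>.\<close>
  have nk: "norm (k (z t)) \<le> 2 * D * norm x" for t
  proof -
    have "norm (F (z t) x - u\<^sub>0) \<le> norm x + norm x"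
      unfolding u\<^sub>0_def
      by (intro order_trans[OF norm_triangle_ineq4] add_mono norm_F_le z scaled_in_disk a)
    then have "D * norm (F (z t) x - u\<^sub>0) \<le> D * (norm x + norm x)"
      using bound_nonneg by (intro mult_left_mono) auto
    then show ?thesis
      using norm_G_apply[OF z, of t "F (z t) x - u\<^sub>0"] unfolding k_def by simp
  qed
  have "(norm (F (z t) x))\<^sup>2 \<le> 2 * inner (F (z t) x) u\<^sub>0 - (norm u\<^sub>0)\<^sup>2
      + 2 * inner (k (z t)) x - 2 * inner (F (z t) (k (z t))) u\<^sub>0
      + 4 * D * norm x * ?s t + (norm (q (z t)))\<^sup>2" for t
  proof -
    have "(norm (F (z t) x))\<^sup>2 \<le> (norm x)\<^sup>2"
      by (intro power_mono norm_F_le z) simp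
    then have "norm (k (z t)) * ?s t \<le> 2 * D * norm x * ?s t"
      by (intro mult_right_mono nk) simp
    then show ?thesis
      using left_inverse_estimate[of "F (z t)" "G (z t)" x u\<^sub>0, OF norm_F_le[OF z] GF[OF z]]
      unfolding k_def q_def by simp
  qed
  then have "(\<integral>t. (norm (F (z t) x))\<^sup>2 \<partial>poisson_measure a)
    \<le> (\<integral>t. 2 * inner (F (z t) x) u\<^sub>0 - (norm u\<^sub>0)\<^sup>2
      + 2 * inner (k (z t)) x - 2 * inner (F (z t) (k (z t))) u\<^sub>0
      + 4 * D * norm x * ?s t + (norm (q (z t)))\<^sup>2 \<partial>poisson_measure a)"
    using i1 i2 i3 i4 i5 i6 i7 by (intro integral_mono) auto
  also have "\<dots> = 2 * inner u\<^sub>0 u\<^sub>0 - (norm u\<^sub>0)\<^sup>2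
      + 4 * D * norm x * (\<integral>t. ?s t \<partial>poisson_measure a) + (\<integral>t. (norm (q (z t)))\<^sup>2 \<partial>poisson_measure a)"
    using i1 i2 i3 i4 i5 i7 mean[OF analytic_F, of x u\<^sub>0] mean[OF an_k, of x] mean[OF an_Fk, of u\<^sub>0]
    by (simp add: measure_poisson_measure[OF a] k0 u\<^sub>0_def)
  finally show ?thesis
    by (simp add: z_def q_def u\<^sub>0_def power2_norm_eq_inner blinfun.diff_left)
qed

text \<open>Summation over \<open>E\<close> precedes the limit in \<open>n\<close>: the
  Hilbert-Schmidt bound is uniform in the angle and in \<open>n\<close>, while the defect integrals
  \<open>J n e\<close> tend to zero.\<close>

lemma defect_sum_le:
  assumes a: "a \<in> unit_disk"
    and rank: "\<And>z. z \<in> unit_disk \<Longrightarrow> \<exists>B. range (id_blinfun - (F z o\<^sub>L G z)) \<subseteq> cspan B \<and> finite B \<and> card B \<le> m"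
    and E: "finite E" "\<forall>x\<in>E. \<forall>y\<in>E. cinner x y = (if x = y then 1 else 0)"
  shows "(\<Sum>e\<in>E. (norm e)\<^sup>2 - (norm (F a e))\<^sup>2) \<le> real m * ((1 + C * D) * C)\<^sup>2"
proof -
  define Q where "Q z = id_blinfun - (F z o\<^sub>L G z)" for z
  define z where "z n t = of_real (r n) * cis t" for n t
  have z: "z n t \<in> unit_disk" for n t unfolding z_def by (rule circle_in_disk)
  \<comment> \<open>Two independent points occur because \<open>Q\<close> is evaluated on the circle
    and \<open>F\<close> at the interior point \<open>r n * a\<close>.\<close>
  have hs: "(\<Sum>e\<in>E. (norm (Q w (F w' e)))\<^sup>2) \<le> real m * ((1 + C * D) * C)\<^sup>2"
    if w: "w \<in> unit_disk" "w' \<in> unit_disk" for w w'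
  proof -
    obtain B where B: "range (Q w) \<subseteq> cspan B" "finite B" "card B \<le> m"
      using rank[OF w(1)] unfolding Q_def by blast
    have "clinear_op (Q w o\<^sub>L F w')"
      using F(2) G(2) w
      by (simp add: clinear_op_def Q_def blinfun.diff_left complex_vector.scale_right_diff_distrib)
    moreover have "range (Q w o\<^sub>L F w') \<subseteq> cspan B" using B(1) by auto
    ultimately have "(\<Sum>e\<in>E. (norm ((Q w o\<^sub>L F w') e))\<^sup>2) \<le> real (card B) * (norm (Q w o\<^sub>L F w'))\<^sup>2"
      using B(2) E by (intro sum_norm_finite_rank)
    also have "\<dots> \<le> real m * ((1 + C * D) * C)\<^sup>2"
    proof (intro mult_mono power_mono)
      have "norm (Q w) \<le> norm (id_blinfun :: 'f \<Rightarrow>\<^sub>L 'f) + norm (F w o\<^sub>L G w)"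
        unfolding Q_def by (rule norm_triangle_ineq4)
      also have "\<dots> \<le> 1 + C * D"
        using bound_nonneg
        by (intro add_mono norm_blinfun_id_le order_trans[OF norm_blinfun_compose] mult_mono F(3) G(3) w) auto
      finally have "norm (Q w) \<le> 1 + C * D" .
      then show "norm (Q w o\<^sub>L F w') \<le> (1 + C * D) * C"
        using bound_nonneg
        by (intro order_trans[OF norm_blinfun_compose] mult_mono F(3) w) auto
    qed (use B in auto)
    finally show ?thesis by simp
  qed
  define I where "I n e = (\<integral>t. (norm (F (z n t) e))\<^sup>2 \<partial>poisson_measure a)" for n e
  define J where "J n e = (\<integral>t. sqrt ((norm e)\<^sup>2 - (norm (F (z n t) e))\<^sup>2) \<partial>poisson_measure a)" for n e
  have fin: "(\<Sum>e\<in>E. I n e - (norm (F (of_real (r n) * a) e))\<^sup>2)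
      \<le> (\<Sum>e\<in>E. 4 * D * norm e * J n e) + real m * ((1 + C * D) * C)\<^sup>2" for n
  proof -
    let ?q = "\<lambda>e t. (norm (Q (z n t) (F (of_real (r n) * a) e)))\<^sup>2"
    have iq: "integrable (poisson_measure a) (?q e)" for e
      unfolding Q_def z_def blinfun.diff_left id_blinfun.rep_eq blinfun_apply_blinfun_compose id_apply
      by (intro integral_poisson_measure(1)[OF a] continuous_on_power continuous_on_norm continuous_on_diff
          continuous_on_const continuous_on_circle disk_analytic_continuous_on
          disk_analytic_apply[OF F(1,2)] disk_analytic_apply[OF G(1,2)] disk_analytic_const r)
    have "(\<Sum>e\<in>E. I n e - (norm (F (of_real (r n) * a) e))\<^sup>2)
        \<le> (\<Sum>e\<in>E. 4 * D * norm e * J n e + (\<integral>t. ?q e t \<partial>poisson_measure a))"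
      unfolding I_def J_def Q_def z_def by (intro sum_mono radial_estimate a)
    also have "\<dots> = (\<Sum>e\<in>E. 4 * D * norm e * J n e) + (\<integral>t. (\<Sum>e\<in>E. ?q e t) \<partial>poisson_measure a)"
      using iq by (simp add: sum.distrib)
    also have "(\<integral>t. (\<Sum>e\<in>E. ?q e t) \<partial>poisson_measure a) \<le> (\<integral>t. real m * ((1 + C * D) * C)\<^sup>2 \<partial>poisson_measure a)"
      using iq integral_poisson_measure(1)[OF a continuous_on_const]
      by (intro integral_mono hs z scaled_in_disk a) auto
    finally show ?thesis by (simp add: measure_poisson_measure[OF a])
  qed
  have "(\<lambda>n. \<Sum>e\<in>E. I n e - (norm (F (of_real (r n) * a) e))\<^sup>2) \<longlonglongrightarrow> (\<Sum>e\<in>E. (norm e)\<^sup>2 - (norm (F a e))\<^sup>2)"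
    unfolding I_def z_def
    by (intro tendsto_sum tendsto_diff tendsto_power tendsto_norm F_radial a
        boundary_integral[OF a, of "\<lambda>s. s\<^sup>2"]) (intro continuous_intros)
  moreover have "(\<lambda>n. (\<Sum>e\<in>E. 4 * D * norm e * J n e) + real m * ((1 + C * D) * C)\<^sup>2)
      \<longlonglongrightarrow> (\<Sum>e\<in>E. 4 * D * norm e * sqrt ((norm e)\<^sup>2 - (norm e)\<^sup>2)) + real m * ((1 + C * D) * C)\<^sup>2"
    unfolding J_def z_def
    by (intro tendsto_intros boundary_integral[OF a, of "\<lambda>s. sqrt ((norm _)\<^sup>2 - s\<^sup>2)"])
       (intro continuous_intros)
  ultimately have "(\<Sum>e\<in>E. (norm e)\<^sup>2 - (norm (F a e))\<^sup>2)
      \<le> (\<Sum>e\<in>E. 4 * D * norm e * sqrt ((norm e)\<^sup>2 - (norm e)\<^sup>2)) + real m * ((1 + C * D) * C)\<^sup>2"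
    using fin by (blast intro: LIMSEQ_le)
  then show ?thesis by simp
qed

text \<open>At \<open>z\<^sub>0\<close> the kernel of \<open>Q\<close> is the range of
  \<open>F\<close>, so \<open>Q\<close> is determined by its values on the orthogonal complement of
  that range and has finite rank. Norm-close idempotents obey the same rank bound, and connectedness
  of the disk spreads it.\<close>

lemma complement_rank:
  assumes z\<^sub>0: "z\<^sub>0 \<in> unit_disk" "finite_dimensional (ortho_complement (range (F z\<^sub>0)))"
  obtains m where "\<And>z. z \<in> unit_disk \<Longrightarrow>
    \<exists>B. range (id_blinfun - (F z o\<^sub>L G z)) \<subseteq> cspan B \<and> finite B \<and> card B \<le> m"
proof -
  define Q where "Q z = id_blinfun - (F z o\<^sub>L G z)" for z
  have Q: "Q z x = x - F z (G z x)" for z x by (simp add: Q_def blinfun.diff_left)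
  have lin: "clinear_op (Q z)" if "z \<in> unit_disk" for z
    using F(2) G(2) that
    by (simp add: clinear_op_def Q complex_vector.scale_right_diff_distrib)
  have idem: "Q z o\<^sub>L Q z = Q z" if "z \<in> unit_disk" for z
    by (rule blinfun_eqI) (simp add: Q blinfun.diff_right GF[OF that])
  have ker: "range (F z) = {x. Q z x = 0}" if "z \<in> unit_disk" for z
    by (auto simp: Q GF[OF that])
  interpret Q0: Vector_Spaces.linear "scaleC :: complex \<Rightarrow> 'f \<Rightarrow> 'f" "scaleC :: complex \<Rightarrow> 'f \<Rightarrow> 'f" "Q z\<^sub>0"
    using lin[OF z\<^sub>0(1)] by unfold_locales (auto simp: clinear_op_def blinfun.add_right)
  obtain B where B: "finite B" "ortho_complement (range (F z\<^sub>0)) = cspan B"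
    using z\<^sub>0(2) unfolding finite_dimensional_def by blast
  define m where "m = card (Q z\<^sub>0 ` B)"
  \<comment> \<open>Being the kernel of the bounded operator \<open>Q z\<^sub>0\<close>, the range
    is closed, so the projection onto it exists.\<close>
  have "closed (range (F z\<^sub>0))"
    unfolding ker[OF z\<^sub>0(1)] by (intro closed_Collect_eq continuous_intros)
  moreover have "subspace (range (F z\<^sub>0))"
    unfolding ker[OF z\<^sub>0(1)] by (auto simp: subspace_def blinfun.add_right blinfun.scaleR_right)
  ultimately have proj: "\<exists>p\<in>range (F z\<^sub>0). \<forall>v\<in>range (F z\<^sub>0). inner v (x - p) = 0" for x
    using projection_exists[of "range (F z\<^sub>0)" x] by metis
  have base: "range (Q z\<^sub>0) \<subseteq> cspan (Q z\<^sub>0 ` B)"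
  proof clarify
    fix x
    obtain p where p: "p \<in> range (F z\<^sub>0)" "\<And>v. v \<in> range (F z\<^sub>0) \<Longrightarrow> inner v (x - p) = 0"
      using proj[of x] by blast
    have "cinner (F z\<^sub>0 y) (x - p) = 0" for y
    proof -
      have "\<i> *\<^sub>C F z\<^sub>0 y = F z\<^sub>0 (\<i> *\<^sub>C y)"
        using F(2) z\<^sub>0(1) by (simp add: clinear_op_def)
      then show ?thesis using p(2) by (simp add: complex_eq_iff Re_cinner Im_cinner)
    qed
    then have "x - p \<in> cspan B" unfolding B(2)[symmetric] ortho_complement_def by auto
    then have "Q z\<^sub>0 (x - p) \<in> cspan (Q z\<^sub>0 ` B)"
      using Q0.span_image[of B, folded cspan_def] by blast
    moreover have "Q z\<^sub>0 p = 0" using p(1) ker[OF z\<^sub>0(1)] by blast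
    ultimately show "Q z\<^sub>0 x \<in> cspan (Q z\<^sub>0 ` B)" by (simp add: blinfun.diff_right)
  qed
  have cont: "continuous_on unit_disk Q"
    unfolding Q_def
    by (intro continuous_on_diff continuous_on_const
        bounded_bilinear.continuous_on[OF bounded_bilinear_blinfun_compose]
        disk_analytic_continuous_on F G)
  define R where "R z \<longleftrightarrow> (\<exists>B. range (Q z) \<subseteq> cspan B \<and> finite B \<and> card B \<le> m)" for z
  have step: "R w" if "R z" "z \<in> unit_disk" "w \<in> unit_disk" "norm (Q w - Q z) < 1" for z w
    using that(1) idempotent_range_le[OF lin[OF that(2)] _ _ _ lin[OF that(3)] idem[OF that(3)] that(4)]
    unfolding R_def by blast
  have "R z" if "z \<in> unit_disk" for z
  proof (rule locally_constant_on_disk[OF z\<^sub>0(1) _ _ that])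
    show "R z\<^sub>0" unfolding R_def m_def using base B(1) by blast
    fix z assume z: "z \<in> unit_disk"
    then obtain d where "d > 0" "\<And>w. w \<in> unit_disk \<Longrightarrow> dist w z < d \<Longrightarrow> dist (Q w) (Q z) < 1"
      using cont unfolding continuous_on_iff by (metis zero_less_one)
    \<comment> \<open>Closeness is symmetric, so \<open>step\<close> applies in both directions and
      gives equality of the truth values.\<close>
    then show "\<exists>d>0. \<forall>w\<in>unit_disk. dist w z < d \<longrightarrow> R w = R z"
      using step z by (metis dist_norm norm_minus_commute)
  qed
  then show ?thesis using that unfolding R_def Q_def by blast
qed

end

section \<open>Assembly of the uniform trace bound\<close>

theorem corollary4p2:
  fixes F :: "complex \<Rightarrow> 'e::chilbert_space \<Rightarrow>\<^sub>L 'f::chilbert_space"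
  assumes "separable_space (euclidean :: 'e topology)"
    and "separable_space (euclidean :: 'f topology)"
    and "F \<in> H_infty"
    and "inner_function F"
    and "\<exists>z\<^sub>0\<in>unit_disk. finite_dimensional (ortho_complement (range (blinfun_apply (F z\<^sub>0))))"
    and "left_invertible F"
  shows "(SUP z\<in>unit_disk. trace_norm (id_blinfun - (cadjoint (F z) o\<^sub>L F z))) < \<infinity>"
proof -
  obtain G where G: "G \<in> H_infty" "\<And>z. z \<in> unit_disk \<Longrightarrow> G z o\<^sub>L F z = id_blinfun"
    using assms(6) unfolding left_invertible_def by blast
  obtain C where C: "\<And>z. z \<in> unit_disk \<Longrightarrow> norm (F z) \<le> C"
    using assms(3) unfolding H_infty_def bounded_iff by blast
  obtain D where D: "\<And>z. z \<in> unit_disk \<Longrightarrow> norm (G z) \<le> D"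
    using G(1) unfolding H_infty_def bounded_iff by blast
  define r where "r n = 1 - inverse (real (Suc n))" for n
  have "(\<lambda>n. 1 - inverse (real (Suc n))) \<longlonglongrightarrow> 1 - 0"
    by (intro tendsto_intros LIMSEQ_inverse_real_of_nat)
  then have r: "0 \<le> r n" "r n < 1" "r \<longlonglongrightarrow> 1" for n
    unfolding r_def by (auto simp: field_simps)
  have F': "disk_analytic F" "\<forall>z\<in>unit_disk. clinear_op (F z)"
    and G': "disk_analytic G" "\<forall>z\<in>unit_disk. clinear_op (G z)"
    using assms(3) G(1) by (auto simp: H_infty_def disk_analytic_def)
  have GF: "G z (F z x) = x" if "z \<in> unit_disk" for z x
    by (metis G(2)[OF that] blinfun_apply_blinfun_compose id_blinfun.rep_eq id_apply)
  note facts = F' C G' D assms(4) GF r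
  obtain z\<^sub>0 where z\<^sub>0: "z\<^sub>0 \<in> unit_disk" "finite_dimensional (ortho_complement (range (F z\<^sub>0)))"
    using assms(5) by blast
  obtain m where m: "\<And>z. z \<in> unit_disk \<Longrightarrow>
      \<exists>B. range (id_blinfun - (F z o\<^sub>L G z)) \<subseteq> cspan B \<and> finite B \<and> card B \<le> m"
    using complement_rank[OF facts z\<^sub>0] by blast
  \<comment> \<open>The rank bound \<open>m\<close> and the sup-norm bounds \<open>C\<close> and
    \<open>D\<close> hold on the whole disk, so the right-hand side does not depend on
    \<open>z\<close>.\<close>
  have "trace_norm (id_blinfun - (cadjoint (F z) o\<^sub>L F z)) \<le> ennreal (real m * ((1 + C * D) * C)\<^sup>2)"
    if z: "z \<in> unit_disk" for z
    using F'(2) z norm_F_le[OF facts z] defect_sum_le[OF facts z m]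
    by (intro trace_norm_defect_le) auto
  then have "(SUP z\<in>unit_disk. trace_norm (id_blinfun - (cadjoint (F z) o\<^sub>L F z)))
      \<le> ennreal (real m * ((1 + C * D) * C)\<^sup>2)"
    by (intro SUP_least)
  also have "\<dots> < \<infinity>" by simp
  finally show ?thesis .
qed

end
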